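(* Let $X$ be a finite connected CW complex, let $1\le d\le\dim X$, let $x\in H_{d-1}(X;\mathbb{Z})$, and let $E\colon X_{d-1}\to\mathbb{R}$ be one-to-one. Let $L^\mu$ be the (unique) $(d-1)$-dimensional spanning co-tree of $X$ minimizing $L\mapsto \sum_{b\in L_{d-1}}E_b$ among all $(d-1)$-dimensional spanning co-trees. Then for every $(d-1)$-dimensional spanning co-tree $L$ of $X$, $$\lim_{\beta\to\infty}\frac{\tau_L}{\nabla}=\begin{cases}0,& L\neq L^\mu,\\ 1,& L=L^\mu.\end{cases}$$ In particular, as $\beta\to\infty$ the higher Boltzmann distribution $\rho^B(x)$ converges to the rational $(d-1)$-cycle $\psi_{L^\mu}(\bar x)\in Z_{d-1}(X;\mathbb{Q})$, where $\bar x$ is the image of $x$ in $H_{d-1}(X;\mathbb{Q})$.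
   Context: $X_k$ is the set of $k$-cells of $X$, $X^{(k)}$ the $k$-skeleton, and $Z_k(X;\mathbb{F})$ the cellular $k$-cycles with coefficients in $\mathbb{F}$; $\beta_k(X)=\dim H_k(X;\mathbb{Q})$. The real parameter $\beta>0$ is the inverse temperature. A $(d-1)$-dimensional spanning co-tree of $X$ is a subcomplex $L\subset X$ such that (a) the inclusion induces an isomorphism $H_{d-1}(L;\mathbb{Q})\to H_{d-1}(X;\mathbb{Q})$; (b) $\beta_{d-2}(L)=\beta_{d-2}(X)$; (c) $X^{(d-2)}\subset L\subset X^{(d-1)}$. $L_{d-1}$ denotes the set of $(d-1)$-cells of $L$. When $E$ is one-to-one the minimizer $L^\mu$ is unique. For such $L$, let $\phi_L\colon Z_{d-1}(L;\mathbb{Z})\cong H_{d-1}(L;\mathbb{Z})\to H_{d-1}(X;\mathbb{Z})$ be the map induced by the inclusion; it is an isomorphism after tensoring with $\mathbb{Q}$. Let $\psi_L\colon H_{d-1}(X;\mathbb{Q})\to Z_{d-1}(X;\mathbb{Q})$ be the composite of $(\phi_L\otimes\mathbb{Q})^{-1}$ with the inclusion $Z_{d-1}(L;\mathbb{Q})\subset Z_{d-1}(X;\mathbb{Q})$. The group $H_{d-1}(X,L;\mathbb{Z})$ is finite; $a_L$ denotes its order. The weight of $L$ is $\tau_L=a_L^2\prod_{b\in L_{d-1}}e^{-\beta E_b}$, and $\nabla=\sum_L\tau_L$, the sum over all $(d-1)$-dimensional spanning co-trees. The higher Boltzmann distribution at $x$ is $\rho^B(x)=\frac1\nabla\sum_L\tau_L\psi_L(\bar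 x)\in Z_{d-1}(X;\mathbb{R})$. *)

theory Defs
  imports "HOL-Homology.Homology"
begin

section \<open>Finite CW complexes\<close>

text \<open>A cell is an abstract label; its characteristic map is part of the data, since it also
  fixes the orientation of the cell.\<close>

record ('a, 'c) cw =
  space_of :: "'a topology"
  cells :: "'c set"
  cdim :: "'c \<Rightarrow> nat"
  charmap :: "'c \<Rightarrow> (nat \<Rightarrow> real) \<Rightarrow> 'a"

definition disc :: "nat \<Rightarrow> (nat \<Rightarrow> real) topology" where
  "disc n = subtopology (Euclidean_space n) {x. (\<Sum>i<n. x i ^ 2) \<le> 1}"

definition disc_interior :: "nat \<Rightarrow> (nat \<Rightarrow> real) set" where
  "disc_interior n = {x \<in> topspace (Euclidean_space n). (\<Sum>i<n. x i ^ 2) < 1}"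

definition disc_boundary :: "nat \<Rightarrow> (nat \<Rightarrow> real) set" where
  "disc_boundary n = {x \<in> topspace (Euclidean_space n). (\<Sum>i<n. x i ^ 2) = 1}"

definition open_cell :: "('a, 'c) cw \<Rightarrow> 'c \<Rightarrow> 'a set" where
  "open_cell X e = charmap X e ` disc_interior (cdim X e)"

definition points :: "('a, 'c) cw \<Rightarrow> 'c set \<Rightarrow> 'a set" where
  "points X S = (\<Union>e\<in>S. open_cell X e)"

text \<open>Degrees are integers, so that \<open>k - 1\<close> and \<open>k - 2\<close> make sense for small \<open>k\<close>.\<close>

definition skel :: "('a, 'c) cw \<Rightarrow> int \<Rightarrow> 'c set" where
  "skel X k = {e \<in> cells X. int (cdim X e) \<le> k}"

definition cells_in :: "('a, 'c) cw \<Rightarrow> 'c set \<Rightarrow> int \<Rightarrow> 'c set" where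
  "cells_in X S k = {e \<in> S. int (cdim X e) = k}"

text \<open>With finitely many cells in a Hausdorff space, closure finiteness, the weak topology, and
  the fact that characteristic maps are homeomorphisms from the open discs onto the open cells
  follow from compactness of the discs.\<close>

definition finite_cw :: "('a, 'c) cw \<Rightarrow> bool" where
  "finite_cw X \<longleftrightarrow>
     Hausdorff_space (space_of X) \<and> finite (cells X) \<and>
     topspace (space_of X) = points X (cells X) \<and>
     disjoint_family_on (open_cell X) (cells X) \<and>
     (\<forall>e\<in>cells X.
        continuous_map (disc (cdim X e)) (space_of X) (charmap X e) \<and>
        inj_on (charmap X e) (disc_interior (cdim X e)) \<and>
        charmap X e ` disc_boundary (cdim X e) \<subseteq> points X (skel X (int (cdim X e) - 1)))"

definition cw_dim :: "('a, 'c) cw \<Rightarrow> int" where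
  "cw_dim X = Max (insert (- 1) ((\<lambda>e. int (cdim X e)) ` cells X))"

text \<open>A subcomplex is represented by its set of cells.\<close>

definition subcomplex :: "('a, 'c) cw \<Rightarrow> 'c set \<Rightarrow> bool" where
  "subcomplex X S \<longleftrightarrow> S \<subseteq> cells X \<and>
     (\<forall>e\<in>S. charmap X e ` topspace (disc (cdim X e)) \<subseteq> points X S)"


section \<open>Incidence numbers\<close>

text \<open>The orientation class of the disc: a generator of the infinite cyclic group
  \<open>H\<^sub>k(D\<^sup>k, S\<^sup>k\<^sup>-\<^sup>1; \<int>)\<close>, the same one for all \<open>k\<close>-cells.\<close>

definition disc_class :: "nat \<Rightarrow> (nat \<Rightarrow> real) chain set" where
  "disc_class k = (let G = relative_homology_group (int k) (disc k) (disc_boundary k)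
     in SOME w. w \<in> carrier G \<and> subgroup_generated G {w} = G)"

definition skel_space :: "('a, 'c) cw \<Rightarrow> int \<Rightarrow> 'a topology" where
  "skel_space X k = subtopology (space_of X) (points X (skel X k))"

definition cellular_chain_group :: "('a, 'c) cw \<Rightarrow> int \<Rightarrow> 'a chain set monoid" where
  "cellular_chain_group X k =
     relative_homology_group k (skel_space X k) (points X (skel X (k - 1)))"

definition cell_class :: "('a, 'c) cw \<Rightarrow> 'c \<Rightarrow> 'a chain set" where
  "cell_class X e = (let k = cdim X e
     in hom_induced (int k) (disc k) (disc_boundary k)
          (skel_space X (int k)) (points X (skel X (int k - 1))) (charmap X e) (disc_class k))"

text \<open>The classes of the \<open>(k-1)\<close>-cells form a \<open>\<int>\<close>-basis of \<open>H\<^sub>k\<^sub>-\<^sub>1(X\<^sup>(\<^sup>k\<^sup>-\<^sup>1\<^sup>), X\<^sup>(\<^sup>k\<^sup>-\<^sup>2\<^sup>); \<int>)\<close>, so the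
  coefficients chosen here are uniquely determined on these cells. The map
  \<open>hom_relboundary\<close> is the connecting homomorphism of the triple of skeleta, i.e. the cellular
  boundary operator.\<close>

definition incidence :: "('a, 'c) cw \<Rightarrow> 'c \<Rightarrow> 'c \<Rightarrow> int" where
  "incidence X e = (let k = int (cdim X e); G = cellular_chain_group X (k - 1)
     in SOME n. hom_relboundary k (skel_space X k) (points X (skel X (k - 1)))
                  (points X (skel X (k - 2))) (cell_class X e)
              = finprod G (\<lambda>f. cell_class X f [^]\<^bsub>G\<^esub> (n f :: int))
                  (cells_in X (cells X) (k - 1)))"


section \<open>Cellular homology with coefficients\<close>

text \<open>Chains of the subcomplex \<open>S\<close> are coefficient functions on cells that vanish off the
  \<open>k\<close>-cells of \<open>S\<close>; in this way \<open>C\<^sub>*(S)\<close> is literally a subcomplex of \<open>C\<^sub>*(X)\<close>.\<close>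

definition cell_chains :: "('a, 'c) cw \<Rightarrow> 'c set \<Rightarrow> int \<Rightarrow> ('c \<Rightarrow> 'f::comm_ring_1) set" where
  "cell_chains X S k = {c. \<forall>e. e \<notin> cells_in X S k \<longrightarrow> c e = 0}"

definition bd :: "('a, 'c) cw \<Rightarrow> int \<Rightarrow> ('c \<Rightarrow> 'f::comm_ring_1) \<Rightarrow> 'c \<Rightarrow> 'f" where
  "bd X k c = (\<lambda>f. if f \<in> cells_in X (cells X) (k - 1)
     then \<Sum>e\<in>cells_in X (cells X) k. of_int (incidence X e f) * c e else 0)"

definition cycles :: "('a, 'c) cw \<Rightarrow> 'c set \<Rightarrow> int \<Rightarrow> ('c \<Rightarrow> 'f::comm_ring_1) set" where
  "cycles X S k = {c \<in> cell_chains X S k. bd X k c = (\<lambda>_. 0)}"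

definition boundaries :: "('a, 'c) cw \<Rightarrow> 'c set \<Rightarrow> int \<Rightarrow> ('c \<Rightarrow> 'f::comm_ring_1) set" where
  "boundaries X S k = bd X (k + 1) ` cell_chains X S (k + 1)"

definition additive_group :: "('c \<Rightarrow> 'f::comm_ring_1) set \<Rightarrow> ('c \<Rightarrow> 'f) monoid" where
  "additive_group A = \<lparr>carrier = A, mult = (\<lambda>c c' e. c e + c' e), one = (\<lambda>_. 0)\<rparr>"

definition homology :: "('a, 'c) cw \<Rightarrow> 'c set \<Rightarrow> int \<Rightarrow> ('c \<Rightarrow> 'f::comm_ring_1) set monoid" where
  "homology X S k = additive_group (cycles X S k) Mod boundaries X S k"

definition homology_class ::
    "('a, 'c) cw \<Rightarrow> 'c set \<Rightarrow> int \<Rightarrow> ('c \<Rightarrow> 'f::comm_ring_1) \<Rightarrow> ('c \<Rightarrow> 'f) set" where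
  "homology_class X S k z = boundaries X S k #>\<^bsub>additive_group (cycles X S k)\<^esub> z"

text \<open>The map \<open>H\<^sub>k(S) \<rightarrow> H\<^sub>k(X)\<close> induced by inclusion sends \<open>z + B\<^sub>k(S)\<close> to \<open>z + B\<^sub>k(X)\<close>.\<close>

definition incl_map ::
    "('a, 'c) cw \<Rightarrow> int \<Rightarrow> ('c \<Rightarrow> 'f::comm_ring_1) set \<Rightarrow> ('c \<Rightarrow> 'f) set" where
  "incl_map X k h = boundaries X (cells X) k <#>\<^bsub>additive_group (cycles X (cells X) k)\<^esub> h"

text \<open>Homology of the quotient complex \<open>C\<^sub>*(S) / C\<^sub>*(T)\<close>, in terms of representatives
  in \<open>C\<^sub>k(S)\<close>.\<close>

definition rel_cycles ::
    "('a, 'c) cw \<Rightarrow> 'c set \<Rightarrow> 'c set \<Rightarrow> int \<Rightarrow> ('c \<Rightarrow> 'f::comm_ring_1) set" where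
  "rel_cycles X S T k = {c \<in> cell_chains X S k. bd X k c \<in> cell_chains X T (k - 1)}"

definition rel_boundaries ::
    "('a, 'c) cw \<Rightarrow> 'c set \<Rightarrow> 'c set \<Rightarrow> int \<Rightarrow> ('c \<Rightarrow> 'f::comm_ring_1) set" where
  "rel_boundaries X S T k =
     {\<lambda>e. b e + t e |b t. b \<in> boundaries X S k \<and> t \<in> cell_chains X T k}"

definition rel_homology ::
    "('a, 'c) cw \<Rightarrow> 'c set \<Rightarrow> 'c set \<Rightarrow> int \<Rightarrow> ('c \<Rightarrow> 'f::comm_ring_1) set monoid" where
  "rel_homology X S T k = additive_group (rel_cycles X S T k) Mod rel_boundaries X S T k"

definition homology_scale ::
    "('a, 'c) cw \<Rightarrow> 'c set \<Rightarrow> int \<Rightarrow> 'f::comm_ring_1 \<Rightarrow> ('c \<Rightarrow> 'f) set \<Rightarrow> ('c \<Rightarrow> 'f) set" where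
  "homology_scale X S k r h =
     boundaries X S k <#>\<^bsub>additive_group (cycles X S k)\<^esub> ((\<lambda>c e. r * c e) ` h)"

definition homology_basis ::
    "('a, 'c) cw \<Rightarrow> 'c set \<Rightarrow> int \<Rightarrow> ('c \<Rightarrow> 'f::field) set set \<Rightarrow> bool" where
  "homology_basis X S k A \<longleftrightarrow> finite A \<and> A \<subseteq> carrier (homology X S k) \<and>
     (\<forall>h\<in>carrier (homology X S k). \<exists>!r. r \<in> extensional A \<and>
        h = finprod (homology X S k) (\<lambda>a. homology_scale X S k (r a) a) A)"

definition betti :: "('a, 'c) cw \<Rightarrow> 'c set \<Rightarrow> int \<Rightarrow> nat" where
  "betti X S k = (THE n. \<exists>A :: ('c \<Rightarrow> rat) set set. homology_basis X S k A \<and> card A = n)"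


section \<open>Spanning co-trees and the higher Boltzmann distribution\<close>

text \<open>A co-tree has dimension \<open>d - 1\<close>; it is represented by its set of cells.\<close>

definition cotree :: "('a, 'c) cw \<Rightarrow> int \<Rightarrow> 'c set \<Rightarrow> bool" where
  "cotree X d L \<longleftrightarrow> subcomplex X L \<and>
     incl_map X (d - 1) \<in> iso (homology X L (d - 1) :: ('c \<Rightarrow> rat) set monoid)
                              (homology X (cells X) (d - 1)) \<and>
     betti X L (d - 2) = betti X (cells X) (d - 2) \<and>
     skel X (d - 2) \<subseteq> L \<and> L \<subseteq> skel X (d - 1)"

definition minimal_cotree :: "('a, 'c) cw \<Rightarrow> int \<Rightarrow> ('c \<Rightarrow> real) \<Rightarrow> 'c set \<Rightarrow> bool" where
  "minimal_cotree X d E =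
     is_arg_min (\<lambda>L. \<Sum>b\<in>cells_in X L (d - 1). E b) (cotree X d)"

text \<open>\<open>phi\<close> is \<open>\<phi>\<^sub>L \<otimes> \<rat>\<close>, the composite
  \<open>Z\<^sub>d\<^sub>-\<^sub>1(L; \<rat>) \<cong> H\<^sub>d\<^sub>-\<^sub>1(L; \<rat>) \<rightarrow> H\<^sub>d\<^sub>-\<^sub>1(X; \<rat>)\<close>.\<close>

definition phi :: "('a, 'c) cw \<Rightarrow> int \<Rightarrow> 'c set \<Rightarrow> ('c \<Rightarrow> rat) \<Rightarrow> ('c \<Rightarrow> rat) set" where
  "phi X d L z = incl_map X (d - 1) (homology_class X L (d - 1) z)"

definition psi :: "('a, 'c) cw \<Rightarrow> int \<Rightarrow> 'c set \<Rightarrow> ('c \<Rightarrow> rat) set \<Rightarrow> 'c \<Rightarrow> rat" where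
  "psi X d L h = inv_into (cycles X L (d - 1)) (phi X d L) h"

text \<open>The map \<open>H\<^sub>k(X; \<int>) \<rightarrow> H\<^sub>k(X; \<rat>)\<close>, \<open>z + B\<^sub>k(X; \<int>) \<mapsto> z + B\<^sub>k(X; \<rat>)\<close>.\<close>

definition rationalize :: "('a, 'c) cw \<Rightarrow> int \<Rightarrow> ('c \<Rightarrow> int) set \<Rightarrow> ('c \<Rightarrow> rat) set" where
  "rationalize X k x = incl_map X k ((\<lambda>c e. of_int (c e)) ` x)"

definition torsion_order :: "('a, 'c) cw \<Rightarrow> int \<Rightarrow> 'c set \<Rightarrow> nat" where
  "torsion_order X d L =
     order (rel_homology X (cells X) L (d - 1) :: ('c \<Rightarrow> int) set monoid)"

definition tau :: "('a, 'c) cw \<Rightarrow> int \<Rightarrow> ('c \<Rightarrow> real) \<Rightarrow> real \<Rightarrow> 'c set \<Rightarrow> real" where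
  "tau X d E \<beta> L =
     (real (torsion_order X d L))\<^sup>2 * (\<Prod>b\<in>cells_in X L (d - 1). exp (- \<beta> * E b))"

definition nabla :: "('a, 'c) cw \<Rightarrow> int \<Rightarrow> ('c \<Rightarrow> real) \<Rightarrow> real \<Rightarrow> real" where
  "nabla X d E \<beta> = (\<Sum>L\<in>Collect (cotree X d). tau X d E \<beta> L)"

definition boltzmann ::
    "('a, 'c) cw \<Rightarrow> int \<Rightarrow> ('c \<Rightarrow> real) \<Rightarrow> ('c \<Rightarrow> int) set \<Rightarrow> real \<Rightarrow> 'c \<Rightarrow> real" where
  "boltzmann X d E x \<beta> = (\<lambda>b. 1 / nabla X d E \<beta> *
     (\<Sum>L\<in>Collect (cotree X d).
        tau X d E \<beta> L * of_rat (psi X d L (rationalize X (d - 1) x) b)))"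

end

theory Submission
  imports Defs "HOL-Library.Function_Algebras"
begin

text \<open>The weight of a co-tree \<open>L\<close> is \<open>a\<^sub>L\<^sup>2 exp (- \<beta> w L)\<close>, where \<open>w L\<close> is the total energy of its
  \<open>(d - 1)\<close>-cells. As \<open>a\<^sub>L\<close> does not depend on \<open>\<beta>\<close>, the weights concentrate on the minimizer
  (\<open>gibbs_weights_concentrate\<close>) as soon as two things are known: every \<open>a\<^sub>L\<close> is nonzero, and every other co-tree has
  strictly larger energy. The Boltzmann distribution is a finite average of the cycles \<open>\<psi>\<^sub>L\<close> with these weights,
  so it converges as well.

  Both facts come from one description of co-trees (\<open>cotree_iff\<close>). Let \<open>C\<close> be the rational \<open>(d - 1)\<close>-chains and
  \<open>B\<close> the boundaries among them. A set of cells between the two skeleta is a co-tree if and only if the chains on its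
  \<open>(d - 1)\<close>-cells are a linear complement of \<open>B\<close> in \<open>C\<close>. Hence the co-trees are the bases of the matroid
  represented by the unit chains in \<open>C / B\<close>. They satisfy the exchange property (\<open>cotree_exchange\<close>), and a
  matroid with distinct weights has a unique lightest basis (\<open>minimal_cotree_strict\<close>). Moreover the integral
  chains modulo the boundaries and the chains of \<open>L\<close> form a finitely generated group that vanishes rationally,
  so its order \<open>a\<^sub>L\<close> is finite and positive (\<open>torsion_order_pos\<close>).

  The description of co-trees relies on two properties of cellular homology. One is the rank formula for Betti
  numbers (\<open>betti_add_card\<close>), which turns the equality of Betti numbers into an equality of boundaries. The other is
  that the cellular boundary squares to zero (\<open>bd_bd\<close>). Since incidence numbers are coefficients of
  connecting homomorphisms with respect to the cell classes, this requires that the classes of the \<open>n\<close>-cells form a basis of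
  the relative homology of the \<open>n\<close>-skeleton modulo the \<open>(n - 1)\<close>-skeleton.

  The basis property is reduced to a single cell. Attaching one cell to a closed set \<open>B\<close> gives a pair with the
  homology of the disc modulo its sphere (\<open>iso_attached_cell\<close>): a radial homotopy thickens \<open>B\<close> by a collar, and excision then
  leaves only the open cell. Adding the cells one by one, the exact sequence of a triple shows that the classes
  generate; enlarging the subspace by all cells but one shows that they are independent.\<close>

section \<open>Radial stretching of the disc\<close>

definition radius :: "nat \<Rightarrow> (nat \<Rightarrow> real) \<Rightarrow> real" where
  "radius n x = sqrt (\<Sum>i<n. x i ^ 2)"

definition collar :: "nat \<Rightarrow> (nat \<Rightarrow> real) set" where
  "collar n = {x \<in> topspace (disc n). 1 / 2 \<le> radius n x}"

text \<open>At time \<open>1\<close> the inner disc of radius \<open>1 / 2\<close> has been blown up to the whole disc and the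
  collar has been pushed onto the sphere; at every time each point of the sphere is fixed.\<close>

definition stretch :: "nat \<Rightarrow> real \<Rightarrow> (nat \<Rightarrow> real) \<Rightarrow> nat \<Rightarrow> real" where
  "stretch n t x = (\<lambda>i. ((1 - t) + t / max (1 / 2) (radius n x)) * x i)"

lemma topspace_disc: "topspace (disc n) = {x. (\<forall>i\<ge>n. x i = 0) \<and> radius n x \<le> 1}"
  by (auto simp: disc_def topspace_Euclidean_space radius_def real_sqrt_le_1_iff)

text \<open>The disc carries the product topology, which is the topology of the type \<open>nat \<Rightarrow> real\<close>; so
  compactness, closedness and continuity can be argued with the type class notions.\<close>

lemma disc_eq_top_of_set: "disc n = top_of_set (topspace (disc n))"
  unfolding disc_def Euclidean_space_def
  by (simp add: euclidean_product_topology subtopology_subtopology)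

lemma disc_interior_eq: "disc_interior n = {x \<in> topspace (disc n). radius n x < 1}"
  by (auto simp: topspace_disc disc_interior_def topspace_Euclidean_space radius_def)

lemma disc_boundary_eq: "disc_boundary n = {x \<in> topspace (disc n). radius n x = 1}"
  by (auto simp: topspace_disc disc_boundary_def topspace_Euclidean_space radius_def)

lemma topspace_disc_split:
  "topspace (disc n) = disc_interior n \<union> disc_boundary n"
  "disc_interior n \<inter> disc_boundary n = {}"
  by (auto simp: disc_interior_eq disc_boundary_eq topspace_disc)

lemma radius_nonneg: "0 \<le> radius n x"
  by (simp add: radius_def sum_nonneg)

lemma continuous_on_radius: "continuous_on S (radius n)"
  unfolding radius_def
  by (intro continuous_on_subset[OF _ subset_UNIV, of _ S] continuous_on_real_sqrt continuous_on_sum continuous_on_power continuous_on_product_coordinates)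

lemma radius_scale: "radius n (\<lambda>i. c * x i) = \<bar>c\<bar> * radius n x"
proof -
  have "(\<Sum>i<n. (c * x i)^2) = c^2 * (\<Sum>i<n. x i ^ 2)"
    by (simp add: power_mult_distrib sum_distrib_left)
  then show ?thesis by (simp add: radius_def real_sqrt_mult)
qed

lemma compact_topspace_disc: "compact (topspace (disc n))"
proof -
  let ?K = "{x::nat \<Rightarrow> real. \<forall>i. x i \<in> {-1..1}}"
  have "compactin (product_topology (\<lambda>i. euclideanreal) UNIV) (PiE UNIV (\<lambda>i. {-1..1}))"
    by (subst compactin_PiE) auto
  then have K: "compact (PiE UNIV (\<lambda>i::nat. {-1..1::real}))"
    by (simp add: euclidean_product_topology)
  have "topspace (disc n) \<subseteq> PiE UNIV (\<lambda>i::nat. {-1..1::real})"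
  proof
    fix x assume x: "x \<in> topspace (disc n)"
    have "\<bar>x i\<bar> \<le> 1" for i
    proof (cases "i < n")
      case True
      have "x i ^ 2 \<le> (\<Sum>i<n. x i ^ 2)"
        using True by (intro member_le_sum) auto
      also have "\<dots> \<le> 1" using x by (auto simp: topspace_disc radius_def)
      finally show ?thesis by (simp add: abs_square_le_1)
    qed (use x in \<open>auto simp: topspace_disc\<close>)
    then show "x \<in> PiE UNIV (\<lambda>i::nat. {-1..1::real})"
      by (auto simp: abs_le_iff minus_le_iff)
  qed
  moreover have "closed (topspace (disc n))"
  proof -
    have "topspace (disc n) = {x. \<forall>i\<in>{n..}. x i = 0} \<inter> {x. radius n x \<le> 1}"
      by (auto simp: topspace_disc)
    moreover have "closed {x::nat \<Rightarrow> real. \<forall>i\<in>{n..}. x i = 0}"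
    proof -
      have "{x::nat \<Rightarrow> real. \<forall>i\<in>{n..}. x i = 0} = (\<Inter>i\<in>{n..}. {x. x i = 0})" by auto
      then show ?thesis
        by (auto intro!: closed_INT closed_Collect_eq continuous_on_product_coordinates continuous_intros)
    qed
    moreover have "closed {x. radius n x \<le> 1}"
      by (rule closed_Collect_le[OF continuous_on_radius continuous_on_const])
    ultimately show ?thesis by (simp only: closed_Int)
  qed
  ultimately show ?thesis
    using compact_Int_closed[OF K, of "topspace (disc n)"] by (simp add: inf.absorb2)
qed

lemma compact_space_disc: "compact_space (disc n)"
  using compact_topspace_disc[of n] by (subst disc_eq_top_of_set) (simp add: compact_space_subtopology)

lemma Hausdorff_space_disc: "Hausdorff_space (disc n)"
  by (simp add: disc_def Hausdorff_Euclidean_space Hausdorff_space_subtopology)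

lemma continuous_on_stretch:
  "continuous_on S (\<lambda>(t, x). stretch n t x)"
proof (unfold stretch_def case_prod_unfold, rule continuous_on_coordinatewise_then_product)
  fix i
  have 1: "continuous_on S (\<lambda>p. radius n (snd p))"
    by (rule continuous_on_compose2[OF continuous_on_radius continuous_on_snd[OF continuous_on_id]]) auto
  have 2: "continuous_on S (\<lambda>p. snd p i)"
    by (rule continuous_on_compose2[OF continuous_on_product_coordinates continuous_on_snd[OF continuous_on_id]]) auto
  show "continuous_on S (\<lambda>p. (1 - fst p + fst p / max (1 / 2) (radius n (snd p))) * snd p i)"
    by (intro continuous_intros 1 2) auto
qed

lemma stretch_0: "stretch n 0 x = x"
  by (simp add: stretch_def)

lemma stretch_on_boundary: "x \<in> disc_boundary n \<Longrightarrow> stretch n t x = x"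
  by (simp add: stretch_def disc_boundary_eq)

lemma radius_stretch:
  assumes "0 \<le> t" "t \<le> 1"
  shows "radius n (stretch n t x) = ((1 - t) + t / max (1 / 2) (radius n x)) * radius n x"
  unfolding stretch_def radius_scale using assms by simp

lemma stretch_in_disc:
  assumes t: "0 \<le> t" "t \<le> 1" and x: "x \<in> topspace (disc n)"
  shows "stretch n t x \<in> topspace (disc n)"
proof -
  have r: "0 \<le> radius n x" "radius n x \<le> 1" using x by (auto simp: radius_nonneg topspace_disc)
  have "radius n (stretch n t x) = (1 - t) * radius n x + t * (radius n x / max (1 / 2) (radius n x))"
    by (simp add: radius_stretch t algebra_simps)
  also have "\<dots> \<le> (1 - t) * 1 + t * 1"
    using r t by (intro add_mono mult_left_mono) (auto simp: divide_le_eq)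
  finally show ?thesis
    using x by (auto simp: topspace_disc) (auto simp: stretch_def)
qed

lemma radius_le_stretch:
  assumes t: "0 \<le> t" "t \<le> 1" and x: "x \<in> topspace (disc n)"
  shows "radius n x \<le> radius n (stretch n t x)"
proof -
  have r: "0 \<le> radius n x" "radius n x \<le> 1" using x by (auto simp: radius_nonneg topspace_disc)
  have "1 \<le> 1 / max (1 / 2) (radius n x)" using r by (auto simp: le_divide_eq)
  then have "t * 1 \<le> t * (1 / max (1 / 2) (radius n x))" using t by (intro mult_left_mono)
  then have "1 \<le> (1 - t) + t / max (1 / 2) (radius n x)" by simp
  from mult_right_mono[OF this r(1)] show ?thesis
    by (simp add: radius_stretch t)
qed

lemma stretch_in_collar:
  assumes "0 \<le> t" "t \<le> 1" "x \<in> collar n"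
  shows "stretch n t x \<in> collar n"
  using assms stretch_in_disc radius_le_stretch by (force simp: collar_def)

lemma stretch_1_collar: "x \<in> collar n \<Longrightarrow> stretch n 1 x \<in> disc_boundary n"
  using stretch_in_disc[of 1 x n] radius_stretch[of 1 n x]
  by (auto simp: collar_def disc_boundary_eq max_def)

lemma closed_disc_parts:
  "closed {x \<in> topspace (disc n). radius n x \<le> 1 / 2}" "closed (disc_boundary n)"
proof -
  have c: "closed (topspace (disc n))"
    by (rule compact_imp_closed[OF compact_topspace_disc])
  have "{x \<in> topspace (disc n). radius n x \<le> 1 / 2} = topspace (disc n) \<inter> {x. radius n x \<le> 1/2}"
    "disc_boundary n = topspace (disc n) \<inter> {x. radius n x = 1}" by (auto simp: disc_boundary_eq)
  moreover have "closed {x. radius n x \<le> 1/2}" "closed {x. radius n x = 1}"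
    by (rule closed_Collect_le[OF continuous_on_radius continuous_on_const]
        closed_Collect_eq[OF continuous_on_radius continuous_on_const])+
  ultimately show "closed {x \<in> topspace (disc n). radius n x \<le> 1 / 2}" "closed (disc_boundary n)"
    using c by (auto simp only: closed_Int)
qed

lemma contractible_space_disc: "contractible_space (disc n)"
proof -
  have hom: "(\<lambda>i. t * x i) \<in> topspace (disc n)" if "0 \<le> t" "t \<le> 1" "x \<in> topspace (disc n)" for t x
  proof -
    have "t * radius n x \<le> 1 * 1"
      using that by (intro mult_mono) (auto simp: radius_nonneg topspace_disc)
    then show ?thesis using that by (auto simp: topspace_disc radius_scale)
  qed
  have "homotopic_with (\<lambda>h. True) (disc n) (disc n) (\<lambda>x. \<lambda>i. 0) id"
    unfolding homotopic_with_def
  proof (intro exI conjI allI ballI)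
    show "continuous_map (prod_topology (top_of_set {0..1}) (disc n)) (disc n) (\<lambda>(t, x) i. t * x i)"
      apply (subst (1 2) disc_eq_top_of_set)
      apply (simp add: case_prod_unfold)
      apply (intro conjI)
       apply (rule continuous_on_coordinatewise_then_product)
       apply (intro continuous_intros continuous_on_compose2[OF continuous_on_product_coordinates continuous_on_snd[OF continuous_on_id]])
        apply (use hom in auto)
      done
  qed auto
  then show ?thesis
    unfolding contractible_space_def using homotopic_with_symD by blast
qed

section \<open>Attaching one cell\<close>

lemma iso_cancel_right:
  assumes "h \<in> hom B C" "f \<in> iso A B" "h \<circ> f \<in> iso A C"
  shows "h \<in> iso B C"
  using assms bij_betw_comp_iff[of f "carrier A" "carrier B" h "carrier C"] by (auto simp: iso_def)

lemma iso_cancel_left: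
  assumes "f \<in> hom A B" "g \<in> iso B C" "g \<circ> f \<in> iso A C"
  shows "f \<in> iso A B"
  using assms bij_betw_comp_iff2[of g "carrier B" "carrier C" f "carrier A"]
  by (auto simp: iso_def hom_def)

text \<open>The base \<open>B\<close> is any closed set to which a single cell is glued along its boundary sphere. Both
  the skeleta of a CW complex and the pair consisting of a disc and its boundary are of this form.\<close>

locale cell_attachment =
  fixes Y :: "'a topology" and B :: "'a set" and n :: nat and \<kappa> :: "(nat \<Rightarrow> real) \<Rightarrow> 'a"
  assumes Hausdorff: "Hausdorff_space Y"
    and closed_base: "closedin Y B"
    and continuous: "continuous_map (disc n) Y \<kappa>"
    and inj: "inj_on \<kappa> (disc_interior n)"
    and boundary_into_base: "\<kappa> ` disc_boundary n \<subseteq> B"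
    and base_disjoint: "B \<inter> \<kappa> ` disc_interior n = {}"
    and cover: "topspace Y = B \<union> \<kappa> ` disc_interior n"
begin

text \<open>Excision of \<open>B\<close> asks for a subspace that contains \<open>B\<close> in its interior, which \<open>B\<close> itself need
  not do. The image of a collar provides the room.\<close>

definition thickened_base :: "'a set" where
  "thickened_base = B \<union> \<kappa> ` collar n"

text \<open>The stretching of the disc, carried over to \<open>Y\<close> and continued by the identity on the base. Being
  the identity off the open cell, it is the identity at time \<open>0\<close> at every point of the type.\<close>

definition push :: "real \<times> 'a \<Rightarrow> 'a" where
  "push = (\<lambda>(t, y). if y \<in> \<kappa> ` disc_interior n then \<kappa> (stretch n t (inv_into (disc_interior n) \<kappa> y)) else y)"

lemma push_base: "y \<in> B \<Longrightarrow> push (t, y) = y"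
  using base_disjoint by (auto simp: push_def)

lemma char_in_base_iff: "x \<in> topspace (disc n) \<Longrightarrow> \<kappa> x \<in> B \<longleftrightarrow> x \<in> disc_boundary n"
  using base_disjoint boundary_into_base topspace_disc_split[of n] by auto

lemma push_char: "x \<in> topspace (disc n) \<Longrightarrow> push (t, \<kappa> x) = \<kappa> (stretch n t x)"
proof (cases "x \<in> disc_interior n")
  case True
  then show ?thesis by (simp add: push_def inv_into_f_f[OF inj])
next
  case False
  moreover assume "x \<in> topspace (disc n)"
  ultimately have "x \<in> disc_boundary n" "\<kappa> x \<in> B"
    using boundary_into_base topspace_disc_split(1)[of n] by auto
  then show ?thesis by (simp add: push_base stretch_on_boundary)
qed

lemma closed_map_char: "closed_map (disc n) Y \<kappa>"
  by (rule T1_Spaces.continuous_imp_closed_map[OF continuous compact_space_disc Hausdorff])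

text \<open>The homotopy is defined piecewise on \<open>B\<close> and on the image of the disc. Its preimages of closed
  sets are closed because \<open>[0,1] \<times> disc\<close> is compact and \<open>Y\<close> is Hausdorff, so the map to
  \<open>[0,1] \<times> Y\<close> induced by the characteristic map is closed.\<close>

lemma continuous_map_push: "continuous_map (prod_topology (top_of_set {0..1}) Y) Y push"
proof -
  let ?I = "top_of_set {0..1::real}"
  let ?q = "\<lambda>p. (fst p, \<kappa> (snd p))"
  have "continuous_map (prod_topology ?I (disc n)) (prod_topology ?I Y) ?q"
    by (intro continuous_map_pairedI continuous_map_fst continuous_map_compose[OF continuous_map_snd continuous, unfolded comp_def])
  then have q: "closed_map (prod_topology ?I (disc n)) (prod_topology ?I Y) ?q"
    by (rule T1_Spaces.continuous_imp_closed_map)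
      (simp_all add: compact_space_prod_topology compact_space_disc compact_space_subtopology Hausdorff
        Hausdorff_space_prod_topology Hausdorff_space_subtopology)
  have "continuous_map (prod_topology ?I (disc n)) (disc n) (\<lambda>(t, x). stretch n t x)"
    apply (subst (1 2) disc_eq_top_of_set)
    apply (simp add: continuous_on_stretch)
    apply (use stretch_in_disc in auto)
    done
  from continuous_map_compose[OF this continuous]
  have s: "continuous_map (prod_topology ?I (disc n)) Y (\<lambda>p. \<kappa> (stretch n (fst p) (snd p)))"
    by (simp add: comp_def case_prod_unfold)
  have mem: "\<kappa> (stretch n t x) \<in> topspace Y" if "t \<in> {0..1}" "x \<in> topspace (disc n)" for t x
    using continuous_map_image_subset_topspace[OF continuous] stretch_in_disc[of t x n] that by auto
  have Y: "topspace Y = B \<union> \<kappa> ` topspace (disc n)"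
    using boundary_into_base cover topspace_disc_split[of n] by auto
  show ?thesis
    unfolding continuous_map_closedin
  proof (intro conjI Pi_I allI impI)
    fix p assume "p \<in> topspace (prod_topology ?I Y)"
    then show "push p \<in> topspace Y"
      using Y mem push_char by (force simp: push_base)
  next
    fix C assume C: "closedin Y C"
    let ?M = "{p \<in> topspace (prod_topology ?I (disc n)). \<kappa> (stretch n (fst p) (snd p)) \<in> C}"
    have "closedin (prod_topology ?I (disc n)) ?M"
      using s C by (auto simp: continuous_map_closedin)
    then have 1: "closedin (prod_topology ?I Y) (?q ` ?M)"
      using q by (auto simp: closed_map_def)
    have 2: "closedin (prod_topology ?I Y) ({0..1} \<times> (B \<inter> C))"
      using closed_base C by (simp add: closedin_prod_Times_iff closedin_Int)
    have "{p \<in> topspace (prod_topology ?I Y). push p \<in> C} = ({0..1} \<times> (B \<inter> C)) \<union> ?q ` ?M"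
    proof (intro subset_antisym subsetI)
      fix p assume p: "p \<in> {p \<in> topspace (prod_topology ?I Y). push p \<in> C}"
      obtain t y where ty: "p = (t, y)" by force
      show "p \<in> ({0..1} \<times> (B \<inter> C)) \<union> ?q ` ?M"
      proof (cases "y \<in> B")
        case True
        then show ?thesis using p by (auto simp: ty push_base)
      next
        case False
        then obtain x where x: "x \<in> topspace (disc n)" "y = \<kappa> x" using p Y by (auto simp: ty)
        then have "(t, x) \<in> ?M" using p by (auto simp: ty push_char)
        then show ?thesis unfolding ty x(2) by (intro UnI2 image_eqI[of _ _ "(t, x)"]) auto
      qed
    next
      fix p assume "p \<in> ({0..1} \<times> (B \<inter> C)) \<union> ?q ` ?M"
      then show "p \<in> {p \<in> topspace (prod_topology ?I Y). push p \<in> C}"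
      proof
        assume "p \<in> {0..1} \<times> (B \<inter> C)"
        then show ?thesis using closedin_subset[OF closed_base] by (auto simp: push_base)
      next
        assume "p \<in> ?q ` ?M"
        then show ?thesis using Y by (auto simp: push_char)
      qed
    qed
    then show "closedin (prod_topology ?I Y) {p \<in> topspace (prod_topology ?I Y). push p \<in> C}"
      using 1 2 by (simp add: closedin_Un)
  qed
qed

text \<open>The homotopy preserves both the base and the thickened base, so it may be read as a homotopy of
  maps of either pair.\<close>

lemma homotopic_push:
  assumes "\<And>t. 0 \<le> t \<Longrightarrow> t \<le> 1 \<Longrightarrow> (\<lambda>y. push (t, y)) \<in> S \<rightarrow> S"
  shows "homotopic_with (\<lambda>h. h \<in> S \<rightarrow> S) Y Y (\<lambda>y. push (1, y)) id"
proof -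
  have "homotopic_with (\<lambda>h. h \<in> S \<rightarrow> S) Y Y (\<lambda>y. push (0, y)) (\<lambda>y. push (1, y))"
    unfolding homotopic_with_def using continuous_map_push assms by (intro exI[of _ push]) auto
  moreover have "(\<lambda>y. push (0, y)) = id"
    by (auto simp: push_def stretch_0 f_inv_into_f)
  ultimately show ?thesis
    by (simp add: homotopic_with_symD)
qed

text \<open>The time-one map retracts the thickened base into the base, and it is inverse to the inclusion up
  to the homotopy \<open>push\<close>.\<close>

lemma iso_thicken_base:
  "hom_induced p Y B Y thickened_base id
     \<in> iso (relative_homology_group p Y B) (relative_homology_group p Y thickened_base)"
proof (rule homotopy_equivalence_relative_homology_group_isomorphism[where g = "\<lambda>y. push (1, y)"])
  show "id \<in> B \<rightarrow> thickened_base" by (auto simp: thickened_base_def)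
  show "continuous_map Y Y (\<lambda>y. push (1, y))"
    by (rule continuous_map_compose[OF _ continuous_map_push, where f = "\<lambda>y. (1, y)", unfolded comp_def])
      (simp add: continuous_map_pairedI)
  have c: "x \<in> collar n \<Longrightarrow> x \<in> topspace (disc n)" for x by (simp add: collar_def)
  show "(\<lambda>y. push (1, y)) \<in> thickened_base \<rightarrow> B"
    using push_char stretch_1_collar boundary_into_base c
    by (fastforce simp: thickened_base_def push_base)
  show "homotopic_with (\<lambda>h. h \<in> B \<rightarrow> B) Y Y ((\<lambda>y. push (1, y)) \<circ> id) id"
    using homotopic_push[of B] by (simp add: push_base)
  have "(\<lambda>y. push (t, y)) \<in> thickened_base \<rightarrow> thickened_base" if "0 \<le> t" "t \<le> 1" for t
  proof
    fix y assume "y \<in> thickened_base"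
    then consider "y \<in> B" | x where "x \<in> collar n" "y = \<kappa> x" by (auto simp: thickened_base_def)
    then show "push (t, y) \<in> thickened_base"
    proof cases
      case 1 then show ?thesis by (auto simp: thickened_base_def push_base)
    next
      case 2 then show ?thesis using stretch_in_collar[OF that] c by (auto simp: thickened_base_def push_char)
    qed
  qed
  then show "homotopic_with (\<lambda>k. k \<in> thickened_base \<rightarrow> thickened_base) Y Y (id \<circ> (\<lambda>y. push (1, y))) id"
    using homotopic_push[of thickened_base] by (simp add: comp_def)
qed auto

text \<open>The complement of the image of the half-radius disc is an open neighbourhood of the base inside the
  thickened base, which is what excision needs.\<close>

lemma iso_excise_base:
  "hom_induced p (subtopology Y (topspace Y - B)) (thickened_base - B) Y thickened_base id
     \<in> iso (relative_homology_group p (subtopology Y (topspace Y - B)) (thickened_base - B))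
           (relative_homology_group p Y thickened_base)"
proof -
  let ?core = "{x \<in> topspace (disc n). radius n x \<le> 1 / 2}"
  have sub: "thickened_base \<subseteq> topspace Y"
    using closedin_subset[OF closed_base] continuous_map_image_subset_topspace[OF continuous]
    by (auto simp: thickened_base_def collar_def)
  have "closedin (disc n) ?core"
    using closed_disc_parts(1)[of n] by (subst disc_eq_top_of_set) (auto intro: closed_subset)
  then have "closedin Y (\<kappa> ` ?core)"
    using closed_map_char by (auto simp: closed_map_def)
  then have op: "openin Y (topspace Y - \<kappa> ` ?core)" by auto
  have "B \<subseteq> topspace Y - \<kappa> ` ?core"
    using closedin_subset[OF closed_base] char_in_base_iff by (auto simp: disc_boundary_eq)
  moreover have "topspace Y - \<kappa> ` ?core \<subseteq> thickened_base"
  proof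
    fix y assume y: "y \<in> topspace Y - \<kappa> ` ?core"
    show "y \<in> thickened_base"
    proof (cases "y \<in> B")
      case False
      then obtain x where x: "x \<in> disc_interior n" "y = \<kappa> x" using y cover by auto
      then have "x \<in> topspace (disc n)" "x \<notin> ?core" using y by (auto simp: disc_interior_eq)
      then show ?thesis using x by (auto simp: thickened_base_def collar_def)
    qed (auto simp: thickened_base_def)
  qed
  ultimately have "Y closure_of B \<subseteq> Y interior_of thickened_base"
    using op closed_base by (metis closure_of_closedin interior_of_maximal_eq order_trans)
  from homology_excision_axiom[OF this sub, of p] show ?thesis by simp
qed

lemma homeomorphic_map_interior:
  "homeomorphic_map (subtopology (disc n) (topspace (disc n) - disc_boundary n))
     (subtopology Y (topspace Y - B)) \<kappa>"
proof (rule bijective_closed_imp_homeomorphic_map)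
  have eq: "{x \<in> topspace (disc n). \<kappa> x \<in> topspace Y - B} = topspace (disc n) - disc_boundary n"
    using continuous_map_image_subset_topspace[OF continuous] char_in_base_iff by auto
  show "closed_map (subtopology (disc n) (topspace (disc n) - disc_boundary n)) (subtopology Y (topspace Y - B)) \<kappa>"
    using closed_map_restriction[OF closed_map_char eq] .
  show "continuous_map (subtopology (disc n) (topspace (disc n) - disc_boundary n)) (subtopology Y (topspace Y - B)) \<kappa>"
    using eq continuous by (auto simp: continuous_map_in_subtopology continuous_map_from_subtopology)
  have i: "topspace (disc n) - disc_boundary n = disc_interior n" using topspace_disc_split[of n] by auto
  show "\<kappa> ` topspace (subtopology (disc n) (topspace (disc n) - disc_boundary n)) = topspace (subtopology Y (topspace Y - B))"
    using cover base_disjoint i topspace_disc_split[of n] by auto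
  show "inj_on \<kappa> (topspace (subtopology (disc n) (topspace (disc n) - disc_boundary n)))"
    using inj i topspace_disc_split[of n] by (simp add: Int_absorb1)
qed

end

lemma cell_attachment_disc: "cell_attachment (disc n) (disc_boundary n) n id"
proof
  show "closedin (disc n) (disc_boundary n)"
    using closed_disc_parts(2)[of n] by (subst disc_eq_top_of_set) (auto intro: closed_subset simp: disc_boundary_eq)
qed (use topspace_disc_split[of n] in \<open>auto simp: Hausdorff_space_disc\<close>)

text \<open>Thickening and excision reduce the pair of \<open>Y\<close> and \<open>B\<close> to the open cell and its collar, and
  they reduce the disc and its sphere, which is itself an attachment, to the open disc and its collar. These
  two pairs are homeomorphic through the characteristic map. The theorem follows by cancelling
  isomorphisms in the two naturality squares.\<close>

theorem (in cell_attachment) iso_attached_cell: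
  "hom_induced p (disc n) (disc_boundary n) Y B \<kappa>
     \<in> iso (relative_homology_group p (disc n) (disc_boundary n)) (relative_homology_group p Y B)"
proof -
  interpret D: cell_attachment "disc n" "disc_boundary n" n id by (rule cell_attachment_disc)
  let ?Di = "subtopology (disc n) (topspace (disc n) - disc_boundary n)"
  let ?Yi = "subtopology Y (topspace Y - B)"
  have collar: "D.thickened_base = collar n"
    unfolding D.thickened_base_def by (auto simp: collar_def disc_boundary_eq)
  have cont_i: "continuous_map ?Di ?Yi \<kappa>"
    using homeomorphic_map_interior homeomorphic_imp_continuous_map by blast
  have im: "\<kappa> ` (collar n - disc_boundary n) = thickened_base - B"
  proof -
    have "collar n \<subseteq> topspace (disc n)" by (auto simp: collar_def)
    then show ?thesis using char_in_base_iff by (auto simp: thickened_base_def)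
  qed
  have i: "hom_induced p ?Di (collar n - disc_boundary n) ?Yi (thickened_base - B) \<kappa>
      \<in> iso (relative_homology_group p ?Di (collar n - disc_boundary n))
            (relative_homology_group p ?Yi (thickened_base - B))"
    by (rule homeomorphic_map_relative_homology_iso[OF homeomorphic_map_interior _ im]) (auto simp: collar_def)
  have mid: "hom_induced p (disc n) (collar n) Y thickened_base \<kappa>
      \<in> iso (relative_homology_group p (disc n) (collar n)) (relative_homology_group p Y thickened_base)"
  proof (rule iso_cancel_right[OF hom_induced_hom D.iso_excise_base[unfolded collar]])
    have "hom_induced p (disc n) (collar n) Y thickened_base \<kappa> \<circ>
        hom_induced p ?Di (collar n - disc_boundary n) (disc n) (collar n) id
      = hom_induced p ?Yi (thickened_base - B) Y thickened_base id \<circ>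
        hom_induced p ?Di (collar n - disc_boundary n) ?Yi (thickened_base - B) \<kappa>"
      using continuous cont_i im
      by (subst (1 2) hom_induced_compose[symmetric]) (auto simp: thickened_base_def)
    then show "hom_induced p (disc n) (collar n) Y thickened_base \<kappa> \<circ>
        hom_induced p ?Di (collar n - disc_boundary n) (disc n) (collar n) id
      \<in> iso (relative_homology_group p ?Di (collar n - disc_boundary n)) (relative_homology_group p Y thickened_base)"
      using iso_set_trans[OF i iso_excise_base] by simp
  qed
  show ?thesis
  proof (rule iso_cancel_left[OF hom_induced_hom iso_thicken_base])
    have "hom_induced p Y B Y thickened_base id \<circ> hom_induced p (disc n) (disc_boundary n) Y B \<kappa>
      = hom_induced p (disc n) (collar n) Y thickened_base \<kappa> \<circ>
        hom_induced p (disc n) (disc_boundary n) (disc n) (collar n) id"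
      using continuous boundary_into_base
      by (subst (1 2) hom_induced_compose[symmetric]) (auto simp: thickened_base_def collar_def disc_boundary_eq)
    then show "hom_induced p Y B Y thickened_base id \<circ> hom_induced p (disc n) (disc_boundary n) Y B \<kappa>
      \<in> iso (relative_homology_group p (disc n) (disc_boundary n)) (relative_homology_group p Y thickened_base)"
      using iso_set_trans[OF D.iso_thicken_base[unfolded collar] mid] by simp
  qed
qed

section \<open>Finite products in abelian groups\<close>

lemma hom_finprod_comm_group:
  assumes G: "comm_group G" and H: "comm_group H" and h: "h \<in> hom G H" and f: "f \<in> A \<rightarrow> carrier G"
  shows "h (finprod G f A) = finprod H (\<lambda>a. h (f a)) A"
proof -
  interpret G: comm_group G by fact
  interpret H: comm_group H by fact
  have one: "h \<one>\<^bsub>G\<^esub> = \<one>\<^bsub>H\<^esub>" using hom_one[OF h G.is_group H.is_group] .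
  show ?thesis using f
  proof (induction A rule: infinite_finite_induct)
    case (insert a A)
    then have "(\<lambda>a. h (f a)) \<in> A \<rightarrow> carrier H" "h (f a) \<in> carrier H"
      using hom_in_carrier[OF h] by auto
    with insert show ?case using hom_mult[OF h] by (simp add: Pi_iff)
  qed (simp_all add: one)
qed

lemma (in comm_group) finprod_int_pow:
  assumes "f \<in> A \<rightarrow> carrier G"
  shows "finprod G f A [^] (m::int) = finprod G (\<lambda>a. f a [^] m) A"
proof -
  have "(\<lambda>x. x [^] m) \<in> hom G G" by (auto simp: hom_def int_pow_distrib)
  from hom_finprod_comm_group[OF comm_group_axioms comm_group_axioms this assms] show ?thesis .
qed

lemma (in comm_group) int_pow_sum:
  assumes "x \<in> carrier G" "finite A"
  shows "x [^] (\<Sum>a\<in>A. m a :: int) = finprod G (\<lambda>a. x [^] m a) A"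
  using assms(2)
proof induction
  case (insert a A)
  then show ?case using assms(1) by (simp add: int_pow_mult)
qed simp

lemma (in comm_monoid) finprod_commute:
  assumes "finite A" "\<And>a b. a \<in> A \<Longrightarrow> b \<in> B \<Longrightarrow> f a b \<in> carrier G"
  shows "finprod G (\<lambda>a. finprod G (f a) B) A = finprod G (\<lambda>b. finprod G (\<lambda>a. f a b) A) B"
  using assms
proof (induction A)
  case (insert a A)
  have c: "(\<lambda>a. finprod G (f a) B) \<in> A \<rightarrow> carrier G" "f a \<in> B \<rightarrow> carrier G"
    "(\<lambda>b. finprod G (\<lambda>a. f a b) A) \<in> B \<rightarrow> carrier G"
    using insert.prems by (auto intro!: finprod_closed)
  have "finprod G (\<lambda>a. finprod G (f a) B) (insert a A)
    = finprod G (f a) B \<otimes> finprod G (\<lambda>b. finprod G (\<lambda>a. f a b) A) B"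
    using insert c by simp
  also have "\<dots> = finprod G (\<lambda>b. f a b \<otimes> finprod G (\<lambda>a. f a b) A) B"
    using c by (simp add: finprod_multf)
  also have "\<dots> = finprod G (\<lambda>b. finprod G (\<lambda>a. f a b) (insert a A)) B"
    using insert by (intro finprod_cong') (auto intro!: finprod_closed)
  finally show ?case .
qed simp

section \<open>The orientation class of the disc\<close>

lemma isomorphic_integer_group_disc:
  "relative_homology_group (int k) (disc k) (disc_boundary k) \<cong> integer_group"
proof (cases k)
  case 0
  have "topspace (disc 0) = {\<lambda>_. 0}" by (auto simp: topspace_disc radius_def)
  moreover have "disc_boundary 0 = {}" by (simp add: disc_boundary_def)
  ultimately show ?thesis using homology_coefficients 0 by fastforce
next
  case (Suc m)
  have sphere: "subtopology (disc k) (disc_boundary k) = nsphere m"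
  proof -
    have "{x. (\<Sum>i<k. (x i)\<^sup>2) \<le> 1} \<inter> (topspace (Euclidean_space k) \<inter> {x. (\<Sum>i<k. (x i)\<^sup>2) = 1})
      = topspace (Euclidean_space k) \<inter> {x. (\<Sum>i\<le>m. (x i)\<^sup>2) = 1}"
      by (auto simp: Suc lessThan_Suc_atMost)
    then have "{x. (\<Sum>i<k. (x i)\<^sup>2) \<le> 1} \<inter> disc_boundary k
      = topspace (Euclidean_space k) \<inter> {x. (\<Sum>i\<le>m. (x i)\<^sup>2) = 1}"
      by (auto simp: disc_boundary_def)
    then have "subtopology (disc k) (disc_boundary k)
      = subtopology (Euclidean_space k) (topspace (Euclidean_space k) \<inter> {x. (\<Sum>i\<le>m. (x i)\<^sup>2) = 1})"
      by (simp only: disc_def subtopology_subtopology)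
    then show ?thesis by (simp only: subtopology_restrict nsphere_def Suc)
  qed
  have "topspace (disc k) \<inter> disc_boundary k \<noteq> {}"
    using in_topspace_nsphere[of m] sphere by (metis empty_iff topspace_subtopology)
  from isomorphic_group_relative_homology_of_contractible[OF contractible_space_disc this, of "int k"]
  have "relative_homology_group (int k) (disc k) (disc_boundary k) \<cong> reduced_homology_group (int k - 1) (nsphere m)"
    by (simp only: sphere)
  also have "int k - 1 = int m" by (simp add: Suc)
  also have "reduced_homology_group (int m) (nsphere m) \<cong> integer_group" by (rule reduced_homology_group_nsphere)
  finally show ?thesis .
qed

abbreviation disc_group :: "nat \<Rightarrow> (nat \<Rightarrow> real) chain set monoid" where
  "disc_group k \<equiv> relative_homology_group (int k) (disc k) (disc_boundary k)"

lemma
  shows disc_class_carrier: "disc_class k \<in> carrier (disc_group k)"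
    and disc_class_generates: "carrier (disc_group k) = range (\<lambda>m::int. disc_class k [^]\<^bsub>disc_group k\<^esub> m)"
    and disc_class_torsion_free: "disc_class k [^]\<^bsub>disc_group k\<^esub> (m::int) = \<one>\<^bsub>disc_group k\<^esub> \<longleftrightarrow> m = 0"
proof -
  let ?G = "disc_group k" and ?w = "disc_class k"
  interpret G: group ?G by simp
  have "cyclic_group ?G"
    using isomorphic_group_cyclicity[OF isomorphic_integer_group_disc] by simp
  then have w: "?w \<in> carrier ?G \<and> subgroup_generated ?G {?w} = ?G"
    unfolding cyclic_group_def Bex_def disc_class_def Let_def by (rule someI_ex)
  then show wc: "?w \<in> carrier ?G" by simp
  show gen: "carrier ?G = range (\<lambda>m::int. ?w [^]\<^bsub>?G\<^esub> m)"
    using G.carrier_subgroup_generated_by_singleton[OF wc] w by simp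
  obtain h where h: "h \<in> iso ?G integer_group"
    using isomorphic_integer_group_disc is_iso_def by blast
  then have hh: "h \<in> hom ?G integer_group" and inj: "inj_on h (carrier ?G)" and im: "h ` carrier ?G = UNIV"
    by (auto simp: iso_def bij_betw_def)
  have pow: "h (?w [^]\<^bsub>?G\<^esub> m) = m * h ?w" for m :: int
    using hom_int_pow[OF hh wc] by simp
  have "h ?w \<noteq> 0"
  proof
    assume "h ?w = 0"
    then have "h ` carrier ?G \<subseteq> {0}" unfolding gen using pow by auto
    then show False using im by (metis UNIV_I singletonD subsetD zero_neq_one)
  qed
  moreover have "h \<one>\<^bsub>?G\<^esub> = 0" using hom_one[OF hh] by simp
  ultimately show "?w [^]\<^bsub>?G\<^esub> m = \<one>\<^bsub>?G\<^esub> \<longleftrightarrow> m = 0"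
    using pow[of m] by auto
qed

section \<open>Closed unions of cells\<close>

lemma cell_subset_points: "e \<in> S \<Longrightarrow> open_cell X e \<subseteq> points X S"
  by (auto simp: points_def)

lemma points_mono: "S \<subseteq> T \<Longrightarrow> points X S \<subseteq> points X T"
  by (auto simp: points_def)

lemma points_Un: "points X (S \<union> T) = points X S \<union> points X T"
  by (auto simp: points_def)

lemma points_insert: "points X (insert e S) = open_cell X e \<union> points X S"
  by (auto simp: points_def)

lemma subcomplex_iff:
  "subcomplex X S \<longleftrightarrow> S \<subseteq> cells X \<and> (\<forall>e\<in>S. charmap X e ` disc_boundary (cdim X e) \<subseteq> points X S)"
  using cell_subset_points[of _ S X] by (auto simp: subcomplex_def topspace_disc_split(1) image_Un open_cell_def)

lemma finite_cwD:
  assumes "finite_cw X"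
  shows "Hausdorff_space (space_of X)" "finite (cells X)" "topspace (space_of X) = points X (cells X)"
    "disjoint_family_on (open_cell X) (cells X)"
    "e \<in> cells X \<Longrightarrow> continuous_map (disc (cdim X e)) (space_of X) (charmap X e)"
    "e \<in> cells X \<Longrightarrow> inj_on (charmap X e) (disc_interior (cdim X e))"
    "e \<in> cells X \<Longrightarrow> charmap X e ` disc_boundary (cdim X e) \<subseteq> points X (skel X (int (cdim X e) - 1))"
  using assms by (auto simp: finite_cw_def)

text \<open>A subcomplex is the union of the images of finitely many closed discs, and these are compact.\<close>

lemma subcomplex_points_closed:
  assumes X: "finite_cw X" and S: "subcomplex X S"
  shows "closedin (space_of X) (points X S)"
proof -
  have "points X S = (\<Union>e\<in>S. charmap X e ` topspace (disc (cdim X e)))"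
  proof
    show "points X S \<subseteq> (\<Union>e\<in>S. charmap X e ` topspace (disc (cdim X e)))"
      by (auto simp: points_def open_cell_def topspace_disc_split(1))
    show "(\<Union>e\<in>S. charmap X e ` topspace (disc (cdim X e))) \<subseteq> points X S"
      using S unfolding subcomplex_def by (intro UN_least) (elim conjE bspec)
  qed
  moreover have "closedin (space_of X) (charmap X e ` topspace (disc (cdim X e)))" if "e \<in> S" for e
  proof -
    have "e \<in> cells X" using that S by (auto simp: subcomplex_def)
    then show ?thesis
      using T1_Spaces.continuous_imp_closed_map[OF finite_cwD(5)[OF X] compact_space_disc finite_cwD(1)[OF X]]
      by (simp add: closed_map_def)
  qed
  moreover have "finite S" using finite_cwD(2)[OF X] S finite_subset by (auto simp: subcomplex_def)
  ultimately show ?thesis by (simp del: UN_simps) (rule closedin_Union, auto)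
qed

lemma cell_attachment_insert:
  assumes X: "finite_cw X" and S: "subcomplex X S" and e: "e \<in> cells X" "e \<notin> S"
    and bd: "charmap X e ` disc_boundary (cdim X e) \<subseteq> points X S"
  shows "cell_attachment (subtopology (space_of X) (points X (insert e S))) (points X S) (cdim X e) (charmap X e)"
proof
  have sub: "points X (insert e S) \<subseteq> topspace (space_of X)"
    using S e by (simp add: finite_cwD(3)[OF X] subcomplex_def points_mono)
  show "Hausdorff_space (subtopology (space_of X) (points X (insert e S)))"
    by (rule Hausdorff_space_subtopology[OF finite_cwD(1)[OF X]])
  show "closedin (subtopology (space_of X) (points X (insert e S))) (points X S)"
    using subcomplex_points_closed[OF X S] by (rule closedin_subset_topspace) (simp add: points_insert)
  show "continuous_map (disc (cdim X e)) (subtopology (space_of X) (points X (insert e S))) (charmap X e)"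
    using finite_cwD(5)[OF X e(1)] bd
    by (auto simp: continuous_map_in_subtopology points_insert open_cell_def topspace_disc_split(1))
  show "inj_on (charmap X e) (disc_interior (cdim X e))" by (rule finite_cwD(6)[OF X e(1)])
  show "points X S \<inter> charmap X e ` disc_interior (cdim X e) = {}"
  proof -
    have "open_cell X f \<inter> open_cell X e = {}" if "f \<in> S" for f
    proof -
      have "f \<in> cells X" "f \<noteq> e" using that e S by (auto simp: subcomplex_def)
      then show ?thesis using finite_cwD(4)[OF X] e(1) by (simp add: disjoint_family_on_def)
    qed
    then show ?thesis unfolding points_def open_cell_def[symmetric] by blast
  qed
  show "topspace (subtopology (space_of X) (points X (insert e S))) = points X S \<union> charmap X e ` disc_interior (cdim X e)"
    using sub by (auto simp: points_insert open_cell_def Int_absorb1)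
qed (use bd in simp)

section \<open>Cellular chain groups are free on the cells\<close>

text \<open>The class of a cell in the homology of an arbitrary pair of unions of cells. Cells are added to a
  subcomplex one at a time below, so the class is needed in pairs other than consecutive skeleta.\<close>

definition attached_class :: "('a, 'c) cw \<Rightarrow> 'c set \<Rightarrow> 'c set \<Rightarrow> 'c \<Rightarrow> 'a chain set" where
  "attached_class X S T e = hom_induced (int (cdim X e)) (disc (cdim X e)) (disc_boundary (cdim X e))
     (subtopology (space_of X) (points X T)) (points X S) (charmap X e) (disc_class (cdim X e))"

abbreviation pair_group :: "nat \<Rightarrow> ('a, 'c) cw \<Rightarrow> 'c set \<Rightarrow> 'c set \<Rightarrow> 'a chain set monoid" where
  "pair_group n X S T \<equiv> relative_homology_group (int n) (subtopology (space_of X) (points X T)) (points X S)"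

lemma attached_class_carrier:
  "cdim X e = n \<Longrightarrow> attached_class X S T e \<in> carrier (pair_group n X S T)"
  unfolding attached_class_def by (auto simp: hom_induced_carrier)

lemma charmap_image_points:
  assumes "charmap X e ` disc_boundary (cdim X e) \<subseteq> points X S" "e \<in> T" "S \<subseteq> T"
  shows "charmap X e ` topspace (disc (cdim X e)) \<subseteq> points X T"
  using assms points_mono[of S T X] cell_subset_points[of e T X]
  by (auto simp: topspace_disc_split(1) open_cell_def)

lemma continuous_map_charmap:
  assumes "finite_cw X" "e \<in> cells X" "charmap X e ` topspace (disc (cdim X e)) \<subseteq> points X T"
  shows "continuous_map (disc (cdim X e)) (subtopology (space_of X) (points X T)) (charmap X e)"
  using assms finite_cwD(5)[of X e] by (auto simp: continuous_map_in_subtopology)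

lemma attached_class_inclusion:
  assumes X: "finite_cw X" "e \<in> cells X"
    and im: "charmap X e ` topspace (disc (cdim X e)) \<subseteq> points X T"
       "charmap X e ` disc_boundary (cdim X e) \<subseteq> points X S"
    and sub: "T \<subseteq> T'" "S \<subseteq> S'" and n: "cdim X e = n"
  shows "hom_induced (int n) (subtopology (space_of X) (points X T)) (points X S)
      (subtopology (space_of X) (points X T')) (points X S') id (attached_class X S T e) = attached_class X S' T' e"
proof -
  have "hom_induced (int n) (disc n) (disc_boundary n) (subtopology (space_of X) (points X T')) (points X S') (id \<circ> charmap X e)
    = hom_induced (int n) (subtopology (space_of X) (points X T)) (points X S)
      (subtopology (space_of X) (points X T')) (points X S') id \<circ>
      hom_induced (int n) (disc n) (disc_boundary n) (subtopology (space_of X) (points X T)) (points X S) (charmap X e)"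
  proof (rule hom_induced_compose)
    show "continuous_map (disc n) (subtopology (space_of X) (points X T)) (charmap X e)"
      using continuous_map_charmap[OF X im(1)] n by simp
    show "charmap X e \<in> disc_boundary n \<rightarrow> points X S" using im(2) n by auto
    show "continuous_map (subtopology (space_of X) (points X T)) (subtopology (space_of X) (points X T')) id"
      using points_mono[OF sub(1), of X] by (auto simp: continuous_map_in_subtopology)
    show "id \<in> points X S \<rightarrow> points X S'" using points_mono[OF sub(2), of X] by auto
  qed
  then show ?thesis by (simp add: attached_class_def n)
qed

lemma hom_induced_int_pow:
  assumes "x \<in> carrier (relative_homology_group p X S)"
  shows "hom_induced p X S Y T f (x [^]\<^bsub>relative_homology_group p X S\<^esub> (m::int))
    = hom_induced p X S Y T f x [^]\<^bsub>relative_homology_group p Y T\<^esub> m"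
  by (rule hom_int_pow[OF hom_induced_hom assms group_relative_homology_group group_relative_homology_group])

lemma subcomplex_attach:
  assumes S: "subcomplex X S" and J: "J \<subseteq> cells X"
    and bd: "\<And>e. e \<in> J \<Longrightarrow> charmap X e ` disc_boundary (cdim X e) \<subseteq> points X S"
  shows "subcomplex X (S \<union> J)"
  unfolding subcomplex_iff
proof (intro conjI ballI)
  show "S \<union> J \<subseteq> cells X" using S J by (simp add: subcomplex_iff)
  fix e assume "e \<in> S \<union> J"
  then have "charmap X e ` disc_boundary (cdim X e) \<subseteq> points X S"
    using S[unfolded subcomplex_iff] bd by blast
  then show "charmap X e ` disc_boundary (cdim X e) \<subseteq> points X (S \<union> J)"
    by (simp add: points_Un le_supI1)
qed

lemma trivial_relative_homology_group_self:
  "trivial_group (relative_homology_group p (subtopology X A) A)"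
  using trivial_relative_homology_group_topspace[of p "subtopology X A"]
  by (metis inf_right_idem relative_homology_group_restrict topspace_subtopology)

text \<open>A cell contained in the subspace factors through the homology of the subspace relative to itself.\<close>

lemma attached_class_trivial:
  assumes X: "finite_cw X" "e \<in> cells X"
    and im: "charmap X e ` topspace (disc (cdim X e)) \<subseteq> points X S"
    and sub: "S \<subseteq> T" and n: "cdim X e = n"
  shows "attached_class X S T e = \<one>\<^bsub>pair_group n X S T\<^esub>"
proof -
  have bd: "charmap X e ` disc_boundary (cdim X e) \<subseteq> points X S"
    using im by (auto simp: topspace_disc_split(1))
  have tr: "trivial_group (pair_group n X S S)"
    by (rule trivial_relative_homology_group_self)
  have "attached_class X S S e = \<one>\<^bsub>pair_group n X S S\<^esub>"
    using attached_class_carrier[OF n, of S S] tr by (auto simp: trivial_group_def)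
  then show ?thesis
    using attached_class_inclusion[OF X im bd sub order_refl n]
    by (simp add: hom_one[OF hom_induced_hom] del: one_relative_homology_group)
qed

text \<open>Induction on the set of attached cells. Attaching one more cell \<open>e\<close> on top of \<open>U\<close> makes the homology
  of the pair of the new space and \<open>U\<close> generated by the class of \<open>e\<close>, so after subtracting a multiple of that class
  an element dies there. By the exact sequence of the triple it then comes from \<open>U\<close>, where the
  induction hypothesis applies.\<close>

theorem attached_classes_generate:
  assumes X: "finite_cw X" and S: "subcomplex X S" and J: "finite J" "J \<subseteq> cells X" "J \<inter> S = {}"
    and dim: "\<And>e. e \<in> J \<Longrightarrow> cdim X e = n"
    and bd: "\<And>e. e \<in> J \<Longrightarrow> charmap X e ` disc_boundary (cdim X e) \<subseteq> points X S"
    and h: "h \<in> carrier (pair_group n X S (S \<union> J))"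
  obtains m :: "'c \<Rightarrow> int" where
    "h = finprod (pair_group n X S (S \<union> J)) (\<lambda>e. attached_class X S (S \<union> J) e [^]\<^bsub>pair_group n X S (S \<union> J)\<^esub> m e) J"
proof -
  have "\<exists>m :: 'c \<Rightarrow> int. h = finprod (pair_group n X S (S \<union> J))
      (\<lambda>e. attached_class X S (S \<union> J) e [^]\<^bsub>pair_group n X S (S \<union> J)\<^esub> m e) J"
    using J dim bd h
  proof (induction J arbitrary: h)
    case empty
    have "trivial_group (pair_group n X S S)"
      by (rule trivial_relative_homology_group_self)
    then show ?case using empty by (auto simp: trivial_group_def comm_monoid.finprod_empty[OF comm_group.axioms(1)])
  next
    case (insert e J)
    note Un_insert_right [simp del] one_relative_homology_group [simp del]
    let ?U = "S \<union> J"
    let ?T = "S \<union> insert e J"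
    let ?Y = "subtopology (space_of X) (points X ?T)"
    let ?G = "pair_group n X S ?T" and ?GU = "pair_group n X S ?U" and ?GQ = "pair_group n X ?U ?T"
    let ?j = "hom_induced (int n) ?Y (points X S) ?Y (points X ?U) id"
    let ?i = "hom_induced (int n) (subtopology (space_of X) (points X ?U)) (points X S) ?Y (points X S) id"
    interpret G: comm_group ?G by simp
    interpret G0: comm_group ?GU by simp
    interpret G1: comm_group ?GQ by simp
    have T: "?T = insert e ?U" by auto
    have e: "e \<in> cells X" "cdim X e = n" "e \<notin> ?U" "charmap X e ` disc_boundary (cdim X e) \<subseteq> points X S"
      using insert by auto
    have bdU: "charmap X e ` disc_boundary (cdim X e) \<subseteq> points X ?U"
      using e(4) points_mono[of S ?U X] by auto
    have U: "subcomplex X ?U"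
      by (rule subcomplex_attach[OF S]) (use insert.prems in auto)
    interpret A: cell_attachment ?Y "points X ?U" n "charmap X e"
      using cell_attachment_insert[OF X U e(1,3) bdU] by (simp add: T e(2))
    have "?j h \<in> carrier ?GQ" by (rule hom_induced_carrier)
    then obtain w where w: "w \<in> carrier (disc_group n)"
      "?j h = hom_induced (int n) (disc n) (disc_boundary n) ?Y (points X ?U) (charmap X e) w"
      using A.iso_attached_cell[of "int n"] by (auto simp: iso_def bij_betw_def)
    obtain k :: int where k: "w = disc_class n [^]\<^bsub>disc_group n\<^esub> k"
      using w(1) disc_class_generates[of n] by auto
    have im: "charmap X e ` topspace (disc (cdim X e)) \<subseteq> points X ?T"
      by (rule charmap_image_points[OF e(4)]) auto
    let ?c = "attached_class X S ?T e"
    have c: "?c \<in> carrier ?G" by (rule attached_class_carrier[OF e(2)])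
    have jh: "?j h = ?j (?c [^]\<^bsub>?G\<^esub> k)"
    proof -
      have "?j h = attached_class X ?U ?T e [^]\<^bsub>?GQ\<^esub> k"
        unfolding w(2) k attached_class_def e(2)
        by (rule hom_induced_int_pow[OF disc_class_carrier])
      also have "attached_class X ?U ?T e = ?j ?c"
        using attached_class_inclusion[OF X e(1) im e(4) order_refl _ e(2), of ?U] by simp
      also have "?j ?c [^]\<^bsub>?GQ\<^esub> k = ?j (?c [^]\<^bsub>?G\<^esub> k)"
        by (rule hom_induced_int_pow[OF c, symmetric])
      finally show ?thesis .
    qed
    let ?h' = "h \<otimes>\<^bsub>?G\<^esub> inv\<^bsub>?G\<^esub> (?c [^]\<^bsub>?G\<^esub> k)"
    have hc: "h \<in> carrier ?G" by (rule insert.prems)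
    have h'c: "?h' \<in> carrier ?G" using c hc by auto
    have "?j ?h' = \<one>\<^bsub>?GQ\<^esub>"
    proof -
      interpret j: group_hom ?G ?GQ ?j
        by (simp add: group_hom_def group_hom_axioms_def hom_induced_hom)
      show ?thesis using c hc jh by (simp add: hom_induced_carrier)
    qed
    then have "?h' \<in> kernel ?G ?GQ ?j" using h'c by (simp add: kernel_def)
    moreover have "subtopology ?Y (points X ?U) = subtopology (space_of X) (points X ?U)"
      using points_mono[of ?U ?T X] by (simp add: subtopology_subtopology T Int_absorb1 subset_insertI)
    ultimately have "?h' \<in> ?i ` carrier ?GU"
      using homology_exactness_triple_3[OF points_mono[of S ?U X], of "int n" ?Y] by auto
    then obtain h0 where h0: "h0 \<in> carrier ?GU" "?h' = ?i h0" by auto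
    from insert.IH[OF _ _ _ _ h0(1)] insert.prems obtain m :: "'c \<Rightarrow> int" where
      m: "h0 = finprod ?GU (\<lambda>f. attached_class X S ?U f [^]\<^bsub>?GU\<^esub> m f) J" by auto
    have ac: "attached_class X S ?U f \<in> carrier ?GU" "attached_class X S ?T f \<in> carrier ?G" if "f \<in> J" for f
      using that insert.prems(3) by (auto intro!: attached_class_carrier)
    have "?i h0 = finprod ?G (\<lambda>f. ?i (attached_class X S ?U f [^]\<^bsub>?GU\<^esub> m f)) J"
      unfolding m using ac
      by (intro hom_finprod_comm_group[OF abelian_relative_homology_group abelian_relative_homology_group hom_induced_hom]) auto
    also have "\<dots> = finprod ?G (\<lambda>f. attached_class X S ?T f [^]\<^bsub>?G\<^esub> m f) J"
    proof (rule G.finprod_cong')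
      fix f assume f: "f \<in> J"
      have fc: "f \<in> cells X" "cdim X f = n" "charmap X f ` disc_boundary (cdim X f) \<subseteq> points X S"
        using f insert.prems by auto
      have "charmap X f ` topspace (disc (cdim X f)) \<subseteq> points X ?U"
        by (rule charmap_image_points[OF fc(3)]) (use f in auto)
      from attached_class_inclusion[OF X fc(1) this fc(3) _ order_refl fc(2), of ?T]
      have "?i (attached_class X S ?U f) = attached_class X S ?T f" by auto
      then show "?i (attached_class X S ?U f [^]\<^bsub>?GU\<^esub> m f) = attached_class X S ?T f [^]\<^bsub>?G\<^esub> m f"
        by (simp add: hom_induced_int_pow[OF ac(1)[OF f]])
    qed (use ac in auto)
    finally have ih0: "?h' = finprod ?G (\<lambda>f. attached_class X S ?T f [^]\<^bsub>?G\<^esub> m f) J" using h0 by simp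
    let ?m = "m(e := k)"
    have "finprod ?G (\<lambda>f. attached_class X S ?T f [^]\<^bsub>?G\<^esub> ?m f) (insert e J)
      = ?c [^]\<^bsub>?G\<^esub> k \<otimes>\<^bsub>?G\<^esub> finprod ?G (\<lambda>f. attached_class X S ?T f [^]\<^bsub>?G\<^esub> ?m f) J"
      using insert.hyps ac c by (subst G.finprod_insert) auto
    also have "finprod ?G (\<lambda>f. attached_class X S ?T f [^]\<^bsub>?G\<^esub> ?m f) J = ?h'"
      unfolding ih0 using insert.hyps ac by (intro G.finprod_cong') auto
    also have "?c [^]\<^bsub>?G\<^esub> k \<otimes>\<^bsub>?G\<^esub> ?h' = h"
      using c hc by (simp add: G.m_lcomm)
    finally show ?case by metis
  qed
  then show ?thesis using that by blast
qed

text \<open>Enlarging the subspace by all attached cells except \<open>e\<close> kills the classes of these cells, while the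
  class of \<open>e\<close> becomes the image of the orientation class of the disc under an isomorphism, and so has infinite order.\<close>

theorem attached_classes_independent:
  assumes X: "finite_cw X" and S: "subcomplex X S" and J: "finite J" "J \<subseteq> cells X" "J \<inter> S = {}"
    and dim: "\<And>e. e \<in> J \<Longrightarrow> cdim X e = n"
    and bd: "\<And>e. e \<in> J \<Longrightarrow> charmap X e ` disc_boundary (cdim X e) \<subseteq> points X S"
    and rel: "finprod (pair_group n X S (S \<union> J)) (\<lambda>e. attached_class X S (S \<union> J) e [^]\<^bsub>pair_group n X S (S \<union> J)\<^esub> m e) J
       = \<one>\<^bsub>pair_group n X S (S \<union> J)\<^esub>"
    and e: "e \<in> J"
  shows "m e = (0 :: int)"
proof -
  note one_relative_homology_group [simp del]
  let ?T = "S \<union> J" and ?U = "S \<union> (J - {e})"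
  let ?Y = "subtopology (space_of X) (points X ?T)"
  let ?G = "pair_group n X S ?T" and ?GQ = "pair_group n X ?U ?T"
  let ?j = "hom_induced (int n) ?Y (points X S) ?Y (points X ?U) id"
  interpret G: comm_group ?G by simp
  interpret G1: comm_group ?GQ by simp
  have T: "?T = insert e ?U" using e by auto
  have U: "subcomplex X ?U"
    by (rule subcomplex_attach[OF S]) (use J bd in auto)
  have ec: "e \<in> cells X" "e \<notin> ?U" "cdim X e = n" using e J dim by auto
  have bdU: "charmap X e ` disc_boundary (cdim X e) \<subseteq> points X ?U"
    using bd[OF e] points_mono[of S ?U X] by auto
  interpret A: cell_attachment ?Y "points X ?U" n "charmap X e"
    using cell_attachment_insert[OF X U ec(1,2) bdU] by (simp add: T[symmetric] ec(3))
  have ac: "attached_class X S ?T f \<in> carrier ?G" "attached_class X ?U ?T f \<in> carrier ?GQ" if "f \<in> J" for f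
    using that dim by (auto intro!: attached_class_carrier)
  have jc: "?j (attached_class X S ?T f) = attached_class X ?U ?T f" if f: "f \<in> J" for f
  proof -
    have "charmap X f ` topspace (disc (cdim X f)) \<subseteq> points X ?T"
      by (rule charmap_image_points[OF bd[OF f]]) (use f in auto)
    from attached_class_inclusion[OF X _ this bd[OF f] order_refl _ dim[OF f], of ?U] f J show ?thesis by auto
  qed
  have "\<one>\<^bsub>?GQ\<^esub> = ?j (finprod ?G (\<lambda>f. attached_class X S ?T f [^]\<^bsub>?G\<^esub> m f) J)"
    unfolding rel by (simp add: hom_one[OF hom_induced_hom] del: one_relative_homology_group)
  also have "\<dots> = finprod ?GQ (\<lambda>f. ?j (attached_class X S ?T f [^]\<^bsub>?G\<^esub> m f)) J"
    using ac
    by (intro hom_finprod_comm_group[OF abelian_relative_homology_group abelian_relative_homology_group hom_induced_hom]) auto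
  also have "\<dots> = finprod ?GQ (\<lambda>f. if f = e then attached_class X ?U ?T f [^]\<^bsub>?GQ\<^esub> m f else \<one>\<^bsub>?GQ\<^esub>) J"
  proof (rule G1.finprod_cong')
    fix f assume f: "f \<in> J"
    have "?j (attached_class X S ?T f [^]\<^bsub>?G\<^esub> m f) = attached_class X ?U ?T f [^]\<^bsub>?GQ\<^esub> m f"
      using jc[OF f] by (simp add: hom_induced_int_pow[OF ac(1)[OF f]])
    moreover have "attached_class X ?U ?T f = \<one>\<^bsub>?GQ\<^esub>" if "f \<noteq> e"
    proof (rule attached_class_trivial[OF X])
      show "charmap X f ` topspace (disc (cdim X f)) \<subseteq> points X ?U"
        by (rule charmap_image_points[OF bd[OF f]]) (use f that in auto)
    qed (use f J dim in auto)
    ultimately show "?j (attached_class X S ?T f [^]\<^bsub>?G\<^esub> m f)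
        = (if f = e then attached_class X ?U ?T f [^]\<^bsub>?GQ\<^esub> m f else \<one>\<^bsub>?GQ\<^esub>)" by simp
  qed (use ac in auto)
  also have "\<dots> = attached_class X ?U ?T e [^]\<^bsub>?GQ\<^esub> m e"
    using G1.finprod_singleton_swap[OF e J(1), of "\<lambda>f. attached_class X ?U ?T f [^]\<^bsub>?GQ\<^esub> m f"] ac by auto
  also have "\<dots> = hom_induced (int n) (disc n) (disc_boundary n) ?Y (points X ?U) (charmap X e)
      (disc_class n [^]\<^bsub>disc_group n\<^esub> m e)"
    unfolding attached_class_def ec(3)
    by (rule hom_induced_int_pow[OF disc_class_carrier, symmetric])
  finally have eq: "hom_induced (int n) (disc n) (disc_boundary n) ?Y (points X ?U) (charmap X e)
      (disc_class n [^]\<^bsub>disc_group n\<^esub> m e) = \<one>\<^bsub>?GQ\<^esub>" by simp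
  interpret D: group "disc_group n" by simp
  have "inj_on (hom_induced (int n) (disc n) (disc_boundary n) ?Y (points X ?U) (charmap X e)) (carrier (disc_group n))"
    using A.iso_attached_cell[of "int n"] by (auto simp: iso_def bij_betw_def)
  moreover have "hom_induced (int n) (disc n) (disc_boundary n) ?Y (points X ?U) (charmap X e) \<one>\<^bsub>disc_group n\<^esub> = \<one>\<^bsub>?GQ\<^esub>"
    by (rule hom_one[OF hom_induced_hom]) auto
  ultimately have "disc_class n [^]\<^bsub>disc_group n\<^esub> m e = \<one>\<^bsub>disc_group n\<^esub>"
    using eq D.int_pow_closed[OF disc_class_carrier] D.one_closed by (metis inj_onD)
  then show ?thesis by (simp add: disc_class_torsion_free del: one_relative_homology_group)
qed

section \<open>The cellular boundary squares to zero\<close>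

lemma subcomplex_skel:
  assumes "finite_cw X"
  shows "subcomplex X (skel X k)"
  unfolding subcomplex_iff
proof (intro conjI ballI)
  fix e assume e: "e \<in> skel X k"
  then have "skel X (int (cdim X e) - 1) \<subseteq> skel X k" by (auto simp: skel_def)
  then show "charmap X e ` disc_boundary (cdim X e) \<subseteq> points X (skel X k)"
    using finite_cwD(7)[OF assms, of e] e points_mono by (fastforce simp: skel_def)
qed (auto simp: skel_def)

lemma skel_split: "skel X k = skel X (k - 1) \<union> cells_in X (cells X) k"
  by (auto simp: skel_def cells_in_def)

lemma cellular_chain_group_eq:
  "cellular_chain_group X (int n) = pair_group n X (skel X (int n - 1)) (skel X (int n))"
  by (simp add: cellular_chain_group_def skel_space_def)

lemma cell_class_eq: "cdim X e = n \<Longrightarrow> cell_class X e = attached_class X (skel X (int n - 1)) (skel X (int n)) e"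
  by (auto simp: cell_class_def attached_class_def skel_space_def Let_def)

lemma cell_class_carrier: "cdim X e = n \<Longrightarrow> cell_class X e \<in> carrier (cellular_chain_group X (int n))"
  unfolding cellular_chain_group_eq by (simp add: cell_class_eq attached_class_carrier)

context
  fixes X :: "('a, 'c) cw"
  assumes X: "finite_cw X"
begin

lemma finite_cells_in: "finite (cells_in X (cells X) k)"
  using finite_cwD(2)[OF X] by (auto simp: cells_in_def)

lemma cells_in_boundary:
  "e \<in> cells_in X (cells X) (int n) \<Longrightarrow> charmap X e ` disc_boundary (cdim X e) \<subseteq> points X (skel X (int n - 1))"
  using finite_cwD(7)[OF X, of e] by (auto simp: cells_in_def)

lemma cell_classes_generate:
  assumes "h \<in> carrier (cellular_chain_group X (int n))"
  obtains m :: "'c \<Rightarrow> int" where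
    "h = finprod (cellular_chain_group X (int n)) (\<lambda>e. cell_class X e [^]\<^bsub>cellular_chain_group X (int n)\<^esub> m e)
       (cells_in X (cells X) (int n))"
proof -
  let ?S = "skel X (int n - 1)" and ?J = "cells_in X (cells X) (int n)"
  have sk: "skel X (int n) = ?S \<union> ?J" by (rule skel_split)
  interpret G: comm_group "pair_group n X ?S (?S \<union> ?J)" by simp
  have cc: "cell_class X e \<in> carrier (pair_group n X ?S (?S \<union> ?J))" if "e \<in> ?J" for e
  proof -
    have "cdim X e = n" using that by (simp add: cells_in_def)
    from cell_class_carrier[OF this] show ?thesis by (simp only: cellular_chain_group_eq sk)
  qed
  obtain m :: "'c \<Rightarrow> int" where m: "h = finprod (pair_group n X ?S (?S \<union> ?J))
      (\<lambda>e. attached_class X ?S (?S \<union> ?J) e [^]\<^bsub>pair_group n X ?S (?S \<union> ?J)\<^esub> m e) ?J"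
  proof (rule attached_classes_generate[OF X subcomplex_skel[OF X] finite_cells_in])
    show "h \<in> carrier (pair_group n X ?S (?S \<union> ?J))"
      using assms by (simp only: cellular_chain_group_eq sk)
  qed (use cells_in_boundary in \<open>auto simp: cells_in_def skel_def\<close>)
  show ?thesis
  proof (rule that[of m], unfold cellular_chain_group_eq sk m, rule G.finprod_cong')
    fix e assume e: "e \<in> ?J"
    then have "cell_class X e = attached_class X ?S (?S \<union> ?J) e"
      using cell_class_eq[of X e n] sk by (simp add: cells_in_def)
    then show "attached_class X ?S (?S \<union> ?J) e [^]\<^bsub>pair_group n X ?S (?S \<union> ?J)\<^esub> m e
      = cell_class X e [^]\<^bsub>pair_group n X ?S (?S \<union> ?J)\<^esub> m e" by simp
  next
    show "(\<lambda>e. cell_class X e [^]\<^bsub>pair_group n X ?S (?S \<union> ?J)\<^esub> m e) \<in> ?J \<rightarrow> carrier (pair_group n X ?S (?S \<union> ?J))"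
      by (intro Pi_I G.int_pow_closed cc)
  qed simp
qed

lemma cell_classes_independent:
  assumes rel: "finprod (cellular_chain_group X (int n)) (\<lambda>e. cell_class X e [^]\<^bsub>cellular_chain_group X (int n)\<^esub> m e)
       (cells_in X (cells X) (int n)) = \<one>\<^bsub>cellular_chain_group X (int n)\<^esub>"
    and e: "e \<in> cells_in X (cells X) (int n)"
  shows "m e = (0 :: int)"
proof -
  let ?S = "skel X (int n - 1)" and ?J = "cells_in X (cells X) (int n)"
  have sk: "skel X (int n) = ?S \<union> ?J" by (rule skel_split)
  interpret G: comm_group "pair_group n X ?S (?S \<union> ?J)" by simp
  have cc: "cell_class X e \<in> carrier (pair_group n X ?S (?S \<union> ?J))" if "e \<in> ?J" for e
  proof -
    have "cdim X e = n" using that by (simp add: cells_in_def)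
    from cell_class_carrier[OF this] show ?thesis by (simp only: cellular_chain_group_eq sk)
  qed
  have cls: "cell_class X e = attached_class X ?S (?S \<union> ?J) e" if "e \<in> ?J" for e
    using that cell_class_eq[of X e n] sk by (simp add: cells_in_def)
  show ?thesis
  proof (rule attached_classes_independent[OF X subcomplex_skel[OF X] finite_cells_in _ _ _ _ _ e])
    have "finprod (pair_group n X ?S (?S \<union> ?J)) (\<lambda>e. attached_class X ?S (?S \<union> ?J) e [^]\<^bsub>pair_group n X ?S (?S \<union> ?J)\<^esub> m e) ?J
      = finprod (pair_group n X ?S (?S \<union> ?J)) (\<lambda>e. cell_class X e [^]\<^bsub>pair_group n X ?S (?S \<union> ?J)\<^esub> m e) ?J"
    proof (rule G.finprod_cong')
      show "(\<lambda>e. cell_class X e [^]\<^bsub>pair_group n X ?S (?S \<union> ?J)\<^esub> m e) \<in> ?J \<rightarrow> carrier (pair_group n X ?S (?S \<union> ?J))"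
        by (intro Pi_I G.int_pow_closed cc)
    qed (simp_all add: cls)
    also have "\<dots> = \<one>\<^bsub>pair_group n X ?S (?S \<union> ?J)\<^esub>"
      using rel unfolding cellular_chain_group_eq sk .
    finally show "finprod (pair_group n X ?S (?S \<union> ?J)) (\<lambda>e. attached_class X ?S (?S \<union> ?J) e [^]\<^bsub>pair_group n X ?S (?S \<union> ?J)\<^esub> m e) ?J
      = \<one>\<^bsub>pair_group n X ?S (?S \<union> ?J)\<^esub>" .
  qed (use cells_in_boundary in \<open>auto simp: cells_in_def skel_def\<close>)
qed

definition cellular_boundary :: "int \<Rightarrow> 'a chain set \<Rightarrow> 'a chain set" where
  "cellular_boundary k = hom_relboundary k (skel_space X k) (points X (skel X (k - 1))) (points X (skel X (k - 2)))"

lemma subtopology_skel_space: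
  assumes "j \<le> k"
  shows "subtopology (skel_space X k) (points X (skel X j)) = skel_space X j"
proof -
  have "skel X j \<subseteq> skel X k" using assms by (auto simp: skel_def)
  then show ?thesis
    using points_mono[of "skel X j" "skel X k" X] by (simp add: skel_space_def subtopology_subtopology Int_absorb1)
qed

lemma cellular_boundary_hom:
  "cellular_boundary k \<in> hom (cellular_chain_group X k) (cellular_chain_group X (k - 1))"
  using group_homomorphism_hom_relboundary[of k "skel_space X k" "points X (skel X (k - 1))" "points X (skel X (k - 2))"]
  by (simp add: cellular_boundary_def cellular_chain_group_def subtopology_skel_space)

text \<open>The composite contains two consecutive maps of the long exact sequence of the pair of the
  \<open>(k - 1)\<close>- and the \<open>(k - 2)\<close>-skeleton.\<close>

lemma cellular_boundary_boundary:
  assumes "x \<in> carrier (cellular_chain_group X k)"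
  shows "cellular_boundary (k - 1) (cellular_boundary k x) = \<one>\<^bsub>cellular_chain_group X (k - 2)\<^esub>"
proof -
  let ?Y = "skel_space X (k - 1)" and ?A = "points X (skel X (k - 2))" and ?B = "points X (skel X (k - 3))"
  define b where "b = hom_boundary k (skel_space X k) (points X (skel X (k - 1))) x"
  have b: "b \<in> carrier (homology_group (k - 1) ?Y)"
    unfolding b_def
    using hom_boundary_carrier[of k "skel_space X k" "points X (skel X (k - 1))" x]
    by (simp add: subtopology_skel_space)
  have "cellular_boundary k x = hom_induced (k - 1) ?Y {} ?Y ?A id b"
    by (simp add: cellular_boundary_def hom_relboundary_def b_def subtopology_skel_space)
  moreover have "hom_boundary (k - 1) ?Y ?A (hom_induced (k - 1) ?Y {} ?Y ?A id b) = \<one>\<^bsub>homology_group (k - 1 - 1) (subtopology ?Y ?A)\<^esub>"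
    using homology_exactness_axiom_1[of "k - 1" ?Y ?A] b by (auto simp: kernel_def)
  ultimately have "cellular_boundary (k - 1) (cellular_boundary k x)
    = hom_induced (k - 1 - 1) (subtopology ?Y ?A) {} (subtopology ?Y ?A) ?B id \<one>\<^bsub>homology_group (k - 1 - 1) (subtopology ?Y ?A)\<^esub>"
    by (simp add: cellular_boundary_def hom_relboundary_def)
  also have "\<dots> = \<one>\<^bsub>relative_homology_group (k - 1 - 1) (subtopology ?Y ?A) ?B\<^esub>"
    by (rule hom_one[OF hom_induced_hom]) auto
  also have "\<dots> = \<one>\<^bsub>cellular_chain_group X (k - 2)\<^esub>"
    by (simp add: cellular_chain_group_def subtopology_skel_space)
  finally show ?thesis .
qed

text \<open>Incidence numbers are defined by a choice, which is meaningful only because the cell classes generate.\<close>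

lemma cellular_boundary_cell:
  assumes "cdim X e = Suc n"
  shows "cellular_boundary (int (Suc n)) (cell_class X e) =
    finprod (cellular_chain_group X (int n)) (\<lambda>f. cell_class X f [^]\<^bsub>cellular_chain_group X (int n)\<^esub> incidence X e f)
      (cells_in X (cells X) (int n))"
proof -
  have k: "int (cdim X e) = int (Suc n)" "int (Suc n) - 1 = int n" by (simp_all add: assms)
  have "cellular_boundary (int (Suc n)) (cell_class X e) \<in> carrier (cellular_chain_group X (int n))"
    using hom_in_carrier[OF cellular_boundary_hom cell_class_carrier[OF assms]] by simp
  then have "\<exists>m :: 'c \<Rightarrow> int. cellular_boundary (int (Suc n)) (cell_class X e) =
      finprod (cellular_chain_group X (int n)) (\<lambda>f. cell_class X f [^]\<^bsub>cellular_chain_group X (int n)\<^esub> m f)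
      (cells_in X (cells X) (int n))"
    by (rule cell_classes_generate) blast
  from someI_ex[OF this] show ?thesis
    unfolding incidence_def Let_def k cellular_boundary_def .
qed

text \<open>Expanding the vanishing double boundary of \<open>e\<close> in the cell classes of dimension \<open>n\<close> and comparing
  coefficients, which is possible because these classes are independent.\<close>

theorem incidence_square_zero:
  assumes e: "cdim X e = Suc (Suc n)" and g: "g \<in> cells_in X (cells X) (int n)"
  shows "(\<Sum>f\<in>cells_in X (cells X) (int (Suc n)). incidence X e f * incidence X f g) = 0"
proof -
  let ?F = "cells_in X (cells X) (int (Suc n))" and ?H = "cells_in X (cells X) (int n)"
  let ?G = "cellular_chain_group X (int n)" and ?GS = "cellular_chain_group X (int (Suc n))"
  have comm: "comm_group (cellular_chain_group X k)" for k by (simp add: cellular_chain_group_def)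
  interpret G: comm_group ?G by (rule comm)
  interpret GS: comm_group ?GS by (rule comm)
  have d: "cdim X f = Suc n" if "f \<in> ?F" for f using that by (simp add: cells_in_def)
  have d0: "cdim X f = n" if "f \<in> ?H" for f using that by (simp add: cells_in_def)
  have bhom: "cellular_boundary (int (Suc n)) \<in> hom ?GS ?G"
    using cellular_boundary_hom[of "int (Suc n)"] by simp
  have cS: "cell_class X f \<in> carrier ?GS" if "f \<in> ?F" for f using cell_class_carrier[OF d[OF that]] .
  have c: "cell_class X f \<in> carrier ?G" if "f \<in> ?H" for f using cell_class_carrier[OF d0[OF that]] .
  have "\<one>\<^bsub>?G\<^esub> = cellular_boundary (int (Suc n)) (cellular_boundary (int (Suc (Suc n))) (cell_class X e))"
    using cellular_boundary_boundary[OF cell_class_carrier[OF e]] by simp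
  also have "\<dots> = cellular_boundary (int (Suc n)) (finprod ?GS (\<lambda>f. cell_class X f [^]\<^bsub>?GS\<^esub> incidence X e f) ?F)"
    by (simp only: cellular_boundary_cell[OF e])
  also have "\<dots> = finprod ?G (\<lambda>f. cellular_boundary (int (Suc n)) (cell_class X f [^]\<^bsub>?GS\<^esub> incidence X e f)) ?F"
    by (rule hom_finprod_comm_group[OF comm comm bhom]) (intro Pi_I GS.int_pow_closed cS)
  also have "\<dots> = finprod ?G (\<lambda>f. finprod ?G (\<lambda>h. cell_class X h [^]\<^bsub>?G\<^esub> (incidence X e f * incidence X f h)) ?H) ?F"
  proof (rule G.finprod_cong')
    fix f assume f: "f \<in> ?F"
    have "cellular_boundary (int (Suc n)) (cell_class X f [^]\<^bsub>?GS\<^esub> incidence X e f)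
      = cellular_boundary (int (Suc n)) (cell_class X f) [^]\<^bsub>?G\<^esub> incidence X e f"
      by (rule hom_int_pow[OF bhom cS[OF f] GS.is_group G.is_group])
    also have "\<dots> = finprod ?G (\<lambda>h. (cell_class X h [^]\<^bsub>?G\<^esub> incidence X f h) [^]\<^bsub>?G\<^esub> incidence X e f) ?H"
      unfolding cellular_boundary_cell[OF d[OF f]] by (rule G.finprod_int_pow) (use c in auto)
    also have "\<dots> = finprod ?G (\<lambda>h. cell_class X h [^]\<^bsub>?G\<^esub> (incidence X e f * incidence X f h)) ?H"
      by (rule G.finprod_cong') (use c in \<open>auto simp: G.int_pow_pow mult.commute\<close>)
    finally show "cellular_boundary (int (Suc n)) (cell_class X f [^]\<^bsub>?GS\<^esub> incidence X e f)
      = finprod ?G (\<lambda>h. cell_class X h [^]\<^bsub>?G\<^esub> (incidence X e f * incidence X f h)) ?H" .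
  qed (use c in \<open>auto intro!: G.finprod_closed\<close>)
  also have "\<dots> = finprod ?G (\<lambda>h. finprod ?G (\<lambda>f. cell_class X h [^]\<^bsub>?G\<^esub> (incidence X e f * incidence X f h)) ?F) ?H"
    by (rule G.finprod_commute) (use c finite_cells_in in auto)
  also have "\<dots> = finprod ?G (\<lambda>h. cell_class X h [^]\<^bsub>?G\<^esub> (\<Sum>f\<in>?F. incidence X e f * incidence X f h)) ?H"
    by (rule G.finprod_cong') (use c in \<open>auto simp: G.int_pow_sum[OF _ finite_cells_in]\<close>)
  finally have "finprod ?G (\<lambda>h. cell_class X h [^]\<^bsub>?G\<^esub> (\<Sum>f\<in>?F. incidence X e f * incidence X f h)) ?H = \<one>\<^bsub>?G\<^esub>"
    by simp
  from cell_classes_independent[OF this g] show ?thesis .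
qed

theorem bd_bd: "bd X (k - 1) (bd X k c) = (\<lambda>_. 0 :: 'f :: comm_ring_1)"
proof
  fix g
  let ?K = "cells_in X (cells X) k" and ?F = "cells_in X (cells X) (k - 1)"
  show "bd X (k - 1) (bd X k c) g = 0"
  proof (cases "g \<in> cells_in X (cells X) (k - 1 - 1)")
    case True
    then have "0 \<le> k - 2" by (auto simp: cells_in_def)
    then obtain n where k: "k - 2 = int n" using nonneg_int_cases by blast
    then have k': "k = int (Suc (Suc n))" "k - 1 = int (Suc n)" "k - 1 - 1 = int n" by auto
    have "bd X (k - 1) (bd X k c) g
      = (\<Sum>f\<in>?F. \<Sum>e\<in>?K. of_int (incidence X f g) * (of_int (incidence X e f) * c e))"
      using True by (simp add: bd_def sum_distrib_left)
    also have "\<dots> = (\<Sum>e\<in>?K. of_int (\<Sum>f\<in>?F. incidence X e f * incidence X f g) * c e)"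
      by (subst sum.swap) (simp add: sum_distrib_right mult.assoc mult.left_commute)
    also have "\<dots> = 0"
    proof (rule sum.neutral, rule ballI)
      fix e assume "e \<in> ?K"
      then have "cdim X e = Suc (Suc n)" using k' by (auto simp: cells_in_def)
      moreover have "g \<in> cells_in X (cells X) (int n)" using True unfolding k'(3) .
      ultimately have "(\<Sum>f\<in>?F. incidence X e f * incidence X f g) = 0"
        unfolding k'(2) by (rule incidence_square_zero)
      then show "of_int (\<Sum>f\<in>?F. incidence X e f * incidence X f g) * c e = 0" by simp
    qed
    finally show ?thesis .
  qed (simp add: bd_def)
qed

end

section \<open>Chains, cycles and boundaries as submodules\<close>

definition fscale :: "'f::comm_ring_1 \<Rightarrow> ('c \<Rightarrow> 'f) \<Rightarrow> 'c \<Rightarrow> 'f" (infixr "*f" 75) where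
  "r *f v = (\<lambda>e. r * v e)"

lemma fscale_apply [simp]: "(r *f v) e = r * v e"
  by (simp add: fscale_def)

interpretation fun_module: Modules.module "fscale :: 'f::comm_ring_1 \<Rightarrow> ('c \<Rightarrow> 'f) \<Rightarrow> 'c \<Rightarrow> 'f"
  by standard (auto simp: fun_eq_iff algebra_simps)

interpretation fun_space: Vector_Spaces.vector_space "fscale :: 'f::field \<Rightarrow> ('c \<Rightarrow> 'f) \<Rightarrow> 'c \<Rightarrow> 'f"
  by standard (auto simp: fun_eq_iff algebra_simps)

lemma sum_apply: "(\<Sum>a\<in>A. f a) e = (\<Sum>a\<in>A. f a e :: 'f::comm_monoid_add)"
  by (induction A rule: infinite_finite_induct) auto

lemma zero_fun_eq: "(\<lambda>_. 0) = (0 :: 'c \<Rightarrow> 'f::zero)"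
  by (simp add: zero_fun_def)

lemma bd_add: "bd X k (u + v) = bd X k u + bd X k v"
  by (auto simp: bd_def fun_eq_iff algebra_simps sum.distrib)

lemma bd_scale: "bd X k (r *f v) = r *f bd X k v"
  by (auto simp: bd_def fun_eq_iff sum_distrib_left mult.left_commute)

lemma bd_0: "bd X k 0 = 0"
  by (simp add: bd_def fun_eq_iff)

lemma bd_diff: "bd X k (u - v) = bd X k u - bd X k v"
  using bd_add[of X k "u - v" v] by (simp add: algebra_simps)

lemma bd_in_cell_chains: "bd X k c \<in> cell_chains X (cells X) (k - 1)"
  by (simp add: bd_def cell_chains_def)

lemma cell_chains_mono: "S \<subseteq> T \<Longrightarrow> cell_chains X S k \<subseteq> cell_chains X T k"
  by (auto simp: cell_chains_def cells_in_def)

lemma subspace_cell_chains: "fun_module.subspace (cell_chains X S k)"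
  by (auto simp: fun_module.subspace_def cell_chains_def)

lemma subspace_cycles: "fun_module.subspace (cycles X S k)"
  using subspace_cell_chains[of X S k]
  by (auto simp: fun_module.subspace_def cycles_def bd_add bd_scale bd_0 zero_fun_eq fun_eq_iff)

lemma subspace_boundaries: "fun_module.subspace (boundaries X S k :: ('c \<Rightarrow> 'f::comm_ring_1) set)"
proof -
  have sub: "fun_module.subspace (cell_chains X S (k + 1) :: ('c \<Rightarrow> 'f) set)" by (rule subspace_cell_chains)
  show ?thesis
    unfolding fun_module.subspace_def boundaries_def
  proof (intro conjI allI ballI)
    show "(0 :: 'c \<Rightarrow> 'f) \<in> bd X (k + 1) ` cell_chains X S (k + 1)"
      using fun_module.subspace_0[OF sub] bd_0 by (metis image_eqI)
    show "u + v \<in> bd X (k + 1) ` cell_chains X S (k + 1)"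
      if "u \<in> bd X (k + 1) ` cell_chains X S (k + 1)" "v \<in> bd X (k + 1) ` cell_chains X S (k + 1)" for u v :: "'c \<Rightarrow> 'f"
      using that fun_module.subspace_add[OF sub] by (auto simp flip: bd_add)
    show "r *f u \<in> bd X (k + 1) ` cell_chains X S (k + 1)"
      if "u \<in> bd X (k + 1) ` cell_chains X S (k + 1)" for r and u :: "'c \<Rightarrow> 'f"
      using that fun_module.subspace_scale[OF sub] by (auto simp flip: bd_scale)
  qed
qed

lemma boundaries_mono: "S \<subseteq> T \<Longrightarrow> boundaries X S k \<subseteq> boundaries X T k"
  using cell_chains_mono by (fastforce simp: boundaries_def)

lemma cycles_mono: "S \<subseteq> T \<Longrightarrow> cycles X S k \<subseteq> cycles X T k"
  using cell_chains_mono by (fastforce simp: cycles_def)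

lemma boundaries_subset_cycles:
  assumes "finite_cw X" "cells_in X S k = cells_in X (cells X) k"
  shows "boundaries X S k \<subseteq> cycles X S k"
proof
  fix b assume "b \<in> boundaries X S k"
  then obtain c where c: "b = bd X (k + 1) c" by (auto simp: boundaries_def)
  have "b \<in> cell_chains X S k"
    using bd_in_cell_chains[of X "k + 1" c] assms(2) by (simp add: c cell_chains_def)
  then show "b \<in> cycles X S k"
    using bd_bd[OF assms(1), of "k + 1" c] by (simp add: cycles_def c)
qed

section \<open>Quotients by boundaries\<close>

text \<open>The cosets that make up the homology groups, freed from the ambient group: the coset of \<open>z\<close> depends
  only on the subgroup and on \<open>z\<close>.\<close>

definition translate :: "('c \<Rightarrow> 'f) set \<Rightarrow> ('c \<Rightarrow> 'f) \<Rightarrow> ('c \<Rightarrow> 'f::comm_ring_1) set" where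
  "translate B z = (\<lambda>b. b + z) ` B"

lemma translate_eq_iff:
  assumes "fun_module.subspace B"
  shows "translate B z = translate B z' \<longleftrightarrow> z - z' \<in> B"
proof
  assume "translate B z = translate B z'"
  moreover have "z \<in> translate B z"
    using fun_module.subspace_0[OF assms] by (force simp: translate_def)
  ultimately obtain b where "b \<in> B" "z = b + z'" by (auto simp: translate_def)
  then show "z - z' \<in> B" by simp
next
  assume d: "z - z' \<in> B"
  have "b + z \<in> translate B z'" if "b \<in> B" for b
    using fun_module.subspace_add[OF assms that d] by (force simp: translate_def algebra_simps image_iff)
  moreover have "b + z' \<in> translate B z" if "b \<in> B" for b
    using fun_module.subspace_diff[OF assms that d] by (force simp: translate_def algebra_simps image_iff)
  ultimately show "translate B z = translate B z'" by (auto simp: translate_def)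
qed

text \<open>This is the shape in which cosets occur in the maps induced by inclusions, by scalar multiplication
  and by extension of coefficients: a coset of a smaller subgroup is enlarged to a coset of a bigger one.\<close>

lemma translate_absorb:
  assumes "fun_module.subspace B" "B0 \<subseteq> B" "0 \<in> B0"
  shows "{b + c | b c. b \<in> B \<and> c \<in> translate B0 z} = translate B z"
proof (intro subset_antisym subsetI)
  fix x assume "x \<in> {b + c | b c. b \<in> B \<and> c \<in> translate B0 z}"
  then obtain b b0 where "b \<in> B" "b0 \<in> B" "x = b + (b0 + z)" using assms(2) by (auto simp: translate_def)
  then show "x \<in> translate B z"
    using fun_module.subspace_add[OF assms(1)] by (auto simp: translate_def add.assoc[symmetric])
next
  fix x assume "x \<in> translate B z"
  moreover have "z \<in> translate B0 z" using assms(3) by (force simp: translate_def)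
  ultimately show "x \<in> {b + c | b c. b \<in> B \<and> c \<in> translate B0 z}" by (auto simp: translate_def)
qed

lemma mult_additive_group: "mult (additive_group A) = (+)"
  by (auto simp: additive_group_def fun_eq_iff)

lemma carrier_additive_group [simp]: "carrier (additive_group A) = A"
  by (simp add: additive_group_def)

lemma one_additive_group: "one (additive_group A) = 0"
  by (simp add: additive_group_def zero_fun_eq)

lemma comm_group_additive_group:
  assumes "fun_module.subspace A"
  shows "comm_group (additive_group A)"
proof (rule comm_groupI)
  fix x assume x: "x \<in> carrier (additive_group A)"
  then have "- x \<in> A" using fun_module.subspace_neg[OF assms] by simp
  then show "\<exists>y\<in>carrier (additive_group A). y \<otimes>\<^bsub>additive_group A\<^esub> x = \<one>\<^bsub>additive_group A\<^esub>"
    by (intro bexI[of _ "- x"]) (auto simp: mult_additive_group one_additive_group)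
qed (use assms in \<open>auto simp: mult_additive_group one_additive_group fun_module.subspace_add fun_module.subspace_0 algebra_simps\<close>)

lemma r_coset_additive_group: "B #>\<^bsub>additive_group A\<^esub> z = translate B z"
  by (auto simp: r_coset_def mult_additive_group translate_def)

lemma set_mult_additive_group: "B <#>\<^bsub>additive_group A\<^esub> C = {b + c | b c. b \<in> B \<and> c \<in> C}"
  by (auto simp: set_mult_def mult_additive_group)

lemma subgroup_additive_group:
  assumes "fun_module.subspace A" "fun_module.subspace B" "B \<subseteq> A"
  shows "subgroup B (additive_group A)"
proof -
  interpret comm_group "additive_group A" by (rule comm_group_additive_group[OF assms(1)])
  show ?thesis
  proof (rule subgroupI)
    fix b assume b: "b \<in> B"
    then have "inv\<^bsub>additive_group A\<^esub> b = - b"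
      using assms fun_module.subspace_neg[OF assms(2) b]
      by (intro inv_equality) (auto simp: mult_additive_group one_additive_group)
    then show "inv\<^bsub>additive_group A\<^esub> b \<in> B" using fun_module.subspace_neg[OF assms(2) b] by simp
  qed (use assms fun_module.subspace_0[OF assms(2)] in \<open>auto simp: mult_additive_group fun_module.subspace_add\<close>)
qed

lemma translate_hom:
  assumes "fun_module.subspace A" "fun_module.subspace B" "B \<subseteq> A"
  shows "translate B \<in> hom (additive_group A) (additive_group A Mod B)"
proof -
  interpret comm_group "additive_group A" by (rule comm_group_additive_group[OF assms(1)])
  interpret normal B "additive_group A"
    by (rule subgroup_imp_normal[OF subgroup_additive_group[OF assms]])
  show ?thesis using r_coset_hom_Mod by (simp add: r_coset_additive_group)
qed

lemma comm_group_quotient: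
  assumes "fun_module.subspace A" "fun_module.subspace B" "B \<subseteq> A"
  shows "comm_group (additive_group A Mod B)"
  using comm_group.abelian_FactGroup[OF comm_group_additive_group subgroup_additive_group] assms by blast

lemma finprod_additive_group:
  assumes A: "fun_module.subspace A" and f: "f \<in> I \<rightarrow> A"
  shows "finprod (additive_group A) f I = (\<Sum>i\<in>I. f i)"
proof -
  interpret comm_group "additive_group A" by (rule comm_group_additive_group[OF A])
  show ?thesis using f
  proof (induction I rule: infinite_finite_induct)
    case (insert i I)
    then show ?case by (simp add: mult_additive_group Pi_iff)
  qed (auto simp: one_additive_group)
qed

lemma carrier_quotient: "carrier (additive_group A Mod B) = translate B ` A"
  by (auto simp: carrier_FactGroup r_coset_additive_group)

lemma carrier_homology: "carrier (homology X S k) = translate (boundaries X S k) ` cycles X S k"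
  by (simp add: homology_def carrier_quotient)

lemma homology_class_eq: "homology_class X S k z = translate (boundaries X S k) z"
  by (simp add: homology_class_def r_coset_additive_group)

lemma incl_map_translate:
  assumes "S \<subseteq> cells X"
  shows "incl_map X k (translate (boundaries X S k) z) = translate (boundaries X (cells X) k) z"
  unfolding incl_map_def set_mult_additive_group
  by (rule translate_absorb[OF subspace_boundaries boundaries_mono[OF assms] fun_module.subspace_0[OF subspace_boundaries]])

lemma homology_scale_translate:
  "homology_scale X S k r (translate (boundaries X S k) z) = translate (boundaries X S k) (r *f z)"
proof -
  let ?B = "boundaries X S k"
  have img: "(\<lambda>c e. r * c e) ` translate ?B z = translate ((\<lambda>b. r *f b) ` ?B) (r *f z)"
    by (force simp: translate_def image_image fun_eq_iff algebra_simps)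
  have sub: "(\<lambda>b. r *f b) ` ?B \<subseteq> ?B"
    using fun_module.subspace_scale[OF subspace_boundaries] by auto
  have "r *f 0 \<in> (\<lambda>b. r *f b) ` ?B"
    by (rule imageI) (rule fun_module.subspace_0[OF subspace_boundaries])
  then have zero: "0 \<in> (\<lambda>b. r *f b) ` ?B" by simp
  show ?thesis
    unfolding homology_scale_def set_mult_additive_group img
    by (rule translate_absorb[OF subspace_boundaries sub zero])
qed

section \<open>Betti numbers\<close>

lemma finprod_homology:
  fixes z :: "'i \<Rightarrow> 'c \<Rightarrow> 'f::comm_ring_1"
  assumes B: "boundaries X S k \<subseteq> (cycles X S k :: ('c \<Rightarrow> 'f) set)" and z: "z \<in> I \<rightarrow> cycles X S k"
  shows "finprod (homology X S k) (\<lambda>i. homology_scale X S k (r i) (translate (boundaries X S k) (z i))) I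
    = translate (boundaries X S k) (\<Sum>i\<in>I. r i *f z i)"
proof -
  have sub: "fun_module.subspace (cycles X S k :: ('c \<Rightarrow> 'f) set)" "fun_module.subspace (boundaries X S k :: ('c \<Rightarrow> 'f) set)"
    by (rule subspace_cycles subspace_boundaries)+
  have rz: "(\<lambda>i. r i *f z i) \<in> I \<rightarrow> cycles X S k"
    using z fun_module.subspace_scale[OF sub(1)] by auto
  have "translate (boundaries X S k) (finprod (additive_group (cycles X S k)) (\<lambda>i. r i *f z i) I)
    = finprod (homology X S k) (\<lambda>i. translate (boundaries X S k) (r i *f z i)) I"
    unfolding homology_def
    by (rule hom_finprod_comm_group[OF comm_group_additive_group[OF sub(1)] comm_group_quotient[OF sub B] translate_hom[OF sub B]])
      (use rz in simp)
  then show ?thesis by (simp add: homology_scale_translate finprod_additive_group[OF sub(1) rz])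
qed

text \<open>A basis of homology, described by representing cycles. It trades the finite products of cosets in
  \<open>homology_basis\<close> for linear algebra in one vector space of functions.\<close>

definition basis_modulo_boundaries :: "('a, 'c) cw \<Rightarrow> 'c set \<Rightarrow> int \<Rightarrow> ('c \<Rightarrow> 'f::field) set \<Rightarrow> bool" where
  "basis_modulo_boundaries X S k R \<longleftrightarrow> finite R \<and> R \<subseteq> cycles X S k \<and>
     (\<forall>r. (\<Sum>v\<in>R. r v *f v) \<in> boundaries X S k \<longrightarrow> (\<forall>v\<in>R. r v = 0)) \<and>
     (\<forall>z\<in>cycles X S k. \<exists>r. z - (\<Sum>v\<in>R. r v *f v) \<in> boundaries X S k)"

lemma homology_basis_imp_basis_modulo_boundaries:
  fixes A :: "('c \<Rightarrow> 'f::field) set set"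
  assumes B: "boundaries X S k \<subseteq> (cycles X S k :: ('c \<Rightarrow> 'f) set)" and A: "homology_basis X S k A"
  obtains R :: "('c \<Rightarrow> 'f) set" where "basis_modulo_boundaries X S k R" "card R = card A"
proof -
  let ?B = "boundaries X S k :: ('c \<Rightarrow> 'f) set" and ?Z = "cycles X S k :: ('c \<Rightarrow> 'f) set"
  have sub: "fun_module.subspace (cycles X S k :: ('c \<Rightarrow> 'f) set)" "fun_module.subspace (boundaries X S k :: ('c \<Rightarrow> 'f) set)"
    by (rule subspace_cycles subspace_boundaries)+
  have A': "finite A" "A \<subseteq> translate ?B ` ?Z"
    "\<And>h. h \<in> translate ?B ` ?Z \<Longrightarrow> \<exists>!r. r \<in> extensional A \<and>
        h = finprod (homology X S k) (\<lambda>a. homology_scale X S k (r a) a) A"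
    using A by (auto simp: homology_basis_def carrier_homology)
  have "\<forall>a\<in>A. \<exists>w. w \<in> ?Z \<and> a = translate ?B w" using A'(2) by auto
  from bchoice[OF this] obtain z where z: "\<And>a. a \<in> A \<Longrightarrow> z a \<in> ?Z \<and> a = translate ?B (z a)"
    by auto
  have inj: "inj_on z A"
    by (rule inj_on_inverseI[of _ "translate ?B"]) (simp add: z[THEN conjunct2, symmetric])
  have fp: "finprod (homology X S k) (\<lambda>a. homology_scale X S k (r a) a) A = translate ?B (\<Sum>a\<in>A. r a *f z a)" for r
  proof -
    interpret H: comm_group "homology X S k :: ('c \<Rightarrow> 'f) set monoid"
      unfolding homology_def by (rule comm_group_quotient[OF sub B])
    have c: "translate ?B w \<in> carrier (homology X S k)" if "w \<in> ?Z" for w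
      using that by (simp add: carrier_homology)
    have "finprod (homology X S k) (\<lambda>a. homology_scale X S k (r a) a) A
      = finprod (homology X S k) (\<lambda>a. homology_scale X S k (r a) (translate ?B (z a))) A"
      by (rule H.finprod_cong')
        (use z c fun_module.subspace_scale[OF sub(1)] in \<open>auto simp: homology_scale_translate\<close>)
    also have "\<dots> = translate ?B (\<Sum>a\<in>A. r a *f z a)"
      by (rule finprod_homology[OF B]) (use z in auto)
    finally show ?thesis .
  qed
  have re: "(\<Sum>v\<in>z ` A. r v *f v) = (\<Sum>a\<in>A. r (z a) *f z a)" for r
    by (simp add: sum.reindex[OF inj])
  have "basis_modulo_boundaries X S k (z ` A)"
    unfolding basis_modulo_boundaries_def
  proof (intro conjI allI impI ballI)
    fix r v assume r: "(\<Sum>v\<in>z ` A. r v *f v) \<in> ?B" and v: "v \<in> z ` A"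
    have "translate ?B (\<Sum>a\<in>A. r (z a) *f z a) = translate ?B 0"
      using r by (subst translate_eq_iff[OF sub(2)]) (simp add: re)
    then have eq: "translate ?B 0 = translate ?B (\<Sum>a\<in>A. r (z a) *f z a)" by simp
    have "translate ?B 0 \<in> translate ?B ` ?Z" using fun_module.subspace_0[OF sub(1)] by auto
    from A'(3)[OF this] obtain r0 where
      r0: "\<And>s. s \<in> extensional A \<Longrightarrow> translate ?B 0 = translate ?B (\<Sum>a\<in>A. s a *f z a) \<Longrightarrow> s = r0"
      unfolding fp by (elim ex1E) blast
    have s: "(\<Sum>a\<in>A. restrict (\<lambda>a. r (z a)) A a *f z a) = (\<Sum>a\<in>A. r (z a) *f z a)"
      "(\<Sum>a\<in>A. restrict (\<lambda>_. 0) A a *f z a) = 0"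
      by (auto intro!: sum.cong sum.neutral)
    have "restrict (\<lambda>a. r (z a)) A = r0"
      by (rule r0[OF restrict_extensional]) (simp only: s(1) eq)
    moreover have "restrict (\<lambda>_. 0) A = r0"
      by (rule r0[OF restrict_extensional]) (simp only: s(2))
    ultimately have rr: "restrict (\<lambda>a. r (z a)) A = restrict (\<lambda>_. 0) A" by simp
    obtain a where a: "a \<in> A" "v = z a" using v by auto
    then show "r v = 0" using fun_cong[OF rr, of a] by simp
  next
    fix w assume "w \<in> ?Z"
    then obtain r where "translate ?B w = translate ?B (\<Sum>a\<in>A. r a *f z a)"
      using A'(3)[of "translate ?B w"] fp by auto
    then have "w - (\<Sum>a\<in>A. r a *f z a) \<in> ?B" by (simp add: translate_eq_iff[OF sub(2)])
    moreover have "(\<Sum>a\<in>A. r a *f z a) = (\<Sum>v\<in>z ` A. r (inv_into A z v) *f v)"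
      unfolding sum.reindex[OF inj] by (intro sum.cong) (simp_all add: inj)
    ultimately show "\<exists>r. w - (\<Sum>v\<in>z ` A. r v *f v) \<in> ?B"
      by (intro exI[of _ "\<lambda>v. r (inv_into A z v)"]) simp
  qed (use A'(1) z in auto)
  moreover have "card (z ` A) = card A" by (rule card_image[OF inj])
  ultimately show ?thesis using that by blast
qed

lemma basis_modulo_boundaries_imp_homology_basis:
  fixes R :: "('c \<Rightarrow> 'f::field) set"
  assumes B: "boundaries X S k \<subseteq> (cycles X S k :: ('c \<Rightarrow> 'f) set)" and R: "basis_modulo_boundaries X S k R"
  shows "homology_basis X S k (translate (boundaries X S k) ` R)"
    and "card (translate (boundaries X S k) ` R) = card R"
proof -
  let ?B = "boundaries X S k :: ('c \<Rightarrow> 'f) set" and ?Z = "cycles X S k :: ('c \<Rightarrow> 'f) set"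
  let ?A = "translate ?B ` R"
  have sub: "fun_module.subspace (cycles X S k :: ('c \<Rightarrow> 'f) set)" "fun_module.subspace (boundaries X S k :: ('c \<Rightarrow> 'f) set)"
    by (rule subspace_cycles subspace_boundaries)+
  have fin: "finite R" and RZ: "R \<subseteq> ?Z"
    and ind: "\<And>r v. (\<Sum>v\<in>R. r v *f v) \<in> ?B \<Longrightarrow> v \<in> R \<Longrightarrow> r v = 0"
    and sp: "\<And>z. z \<in> ?Z \<Longrightarrow> \<exists>r. z - (\<Sum>v\<in>R. r v *f v) \<in> ?B"
    using R unfolding basis_modulo_boundaries_def by blast+
  have inj: "inj_on (translate ?B) R"
  proof (rule inj_onI, rule ccontr)
    fix v w assume vw: "v \<in> R" "w \<in> R" "translate ?B v = translate ?B w" "v \<noteq> w"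
    let ?r = "\<lambda>u. if u = v then 1 else if u = w then - 1 else 0"
    have "(\<Sum>u\<in>R. ?r u *f u) = (\<Sum>u\<in>R. (if u = v then v else 0) - (if u = w then w else 0))"
      using vw(4) by (intro sum.cong) (auto simp: fun_eq_iff)
    also have "\<dots> = v - w" using vw fin by (simp add: sum_subtractf sum.delta)
    finally have "(\<Sum>u\<in>R. ?r u *f u) \<in> ?B" using vw(3) by (simp add: translate_eq_iff[OF sub(2)])
    from ind[OF this vw(1)] show False by simp
  qed
  then show "card ?A = card R" by (rule card_image)
  have fp: "finprod (homology X S k) (\<lambda>a. homology_scale X S k (r a) a) ?A
    = translate ?B (\<Sum>v\<in>R. r (translate ?B v) *f v)" for r
  proof -
    interpret H: comm_group "homology X S k :: ('c \<Rightarrow> 'f) set monoid"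
      unfolding homology_def by (rule comm_group_quotient[OF sub B])
    have "finprod (homology X S k) (\<lambda>a. homology_scale X S k (r a) a) ?A
      = finprod (homology X S k) (\<lambda>v. homology_scale X S k (r (translate ?B v)) (translate ?B v)) R"
      by (rule H.finprod_reindex[OF _ inj])
        (use RZ fun_module.subspace_scale[OF sub(1)] in \<open>auto simp: homology_scale_translate carrier_homology\<close>)
    also have "\<dots> = translate ?B (\<Sum>v\<in>R. r (translate ?B v) *f v)"
      by (rule finprod_homology[OF B]) (use RZ in auto)
    finally show ?thesis .
  qed
  show "homology_basis X S k ?A"
    unfolding homology_basis_def carrier_homology
  proof (intro conjI ballI)
    fix h assume "h \<in> translate ?B ` ?Z"
    then obtain z where z: "z \<in> ?Z" "h = translate ?B z" by auto
    obtain c where c: "z - (\<Sum>v\<in>R. c v *f v) \<in> ?B" using sp[OF z(1)] by auto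
    let ?r = "restrict (\<lambda>a. c (inv_into R (translate ?B) a)) ?A"
    have rc: "(\<Sum>v\<in>R. ?r (translate ?B v) *f v) = (\<Sum>v\<in>R. c v *f v)"
      by (intro sum.cong) (auto simp: inj)
    show "\<exists>!r. r \<in> extensional ?A \<and> h = finprod (homology X S k) (\<lambda>a. homology_scale X S k (r a) a) ?A"
    proof (rule ex1I[of _ ?r])
      show "?r \<in> extensional ?A \<and> h = finprod (homology X S k) (\<lambda>a. homology_scale X S k (?r a) a) ?A"
        using c unfolding fp rc z(2) by (simp add: translate_eq_iff[OF sub(2)])
    next
      fix r assume r: "r \<in> extensional ?A \<and> h = finprod (homology X S k) (\<lambda>a. homology_scale X S k (r a) a) ?A"
      then have "z - (\<Sum>v\<in>R. r (translate ?B v) *f v) \<in> ?B"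
        unfolding fp z(2) by (simp add: translate_eq_iff[OF sub(2)])
      from fun_module.subspace_diff[OF sub(2) this c]
      have "(\<Sum>v\<in>R. c v *f v) - (\<Sum>v\<in>R. r (translate ?B v) *f v) \<in> ?B" by simp
      moreover have "(\<Sum>v\<in>R. c v *f v) - (\<Sum>v\<in>R. r (translate ?B v) *f v)
        = (\<Sum>v\<in>R. (c v - r (translate ?B v)) *f v)"
        by (simp add: sum_subtractf fun_module.scale_left_diff_distrib)
      ultimately have "(\<Sum>v\<in>R. (c v - r (translate ?B v)) *f v) \<in> ?B" by simp
      then have "c v = r (translate ?B v)" if "v \<in> R" for v using ind[of "\<lambda>v. c v - r (translate ?B v)"] that by simp
      then show "r = ?r"
        using r by (intro extensionalityI[of r ?A]) (auto simp: inj)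
    qed
  qed (use fin RZ in auto)
qed

text \<open>Representatives of a basis of the quotient are exactly the sets that complete a basis of the
  boundaries to a basis of the cycles.\<close>

lemma basis_modulo_boundaries_iff:
  fixes Q R :: "('c \<Rightarrow> 'f::field) set"
  assumes B: "boundaries X S k \<subseteq> (cycles X S k :: ('c \<Rightarrow> 'f) set)"
    and Q: "finite Q" "fun_module.independent Q" "fun_module.span Q = boundaries X S k"
  shows "basis_modulo_boundaries X S k R \<longleftrightarrow>
    finite R \<and> Q \<inter> R = {} \<and> fun_module.independent (Q \<union> R) \<and> fun_module.span (Q \<union> R) = cycles X S k"
    (is "?lhs \<longleftrightarrow> ?rhs")
proof
  let ?B = "boundaries X S k :: ('c \<Rightarrow> 'f) set" and ?Z = "cycles X S k :: ('c \<Rightarrow> 'f) set"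
  have sub: "fun_module.subspace (cycles X S k :: ('c \<Rightarrow> 'f) set)" "fun_module.subspace (boundaries X S k :: ('c \<Rightarrow> 'f) set)"
    by (rule subspace_cycles subspace_boundaries)+
  assume ?lhs
  then have fin: "finite R" and RZ: "R \<subseteq> ?Z"
    and ind: "\<And>r v. (\<Sum>v\<in>R. r v *f v) \<in> ?B \<Longrightarrow> v \<in> R \<Longrightarrow> r v = 0"
    and sp: "\<And>z. z \<in> ?Z \<Longrightarrow> \<exists>r. z - (\<Sum>v\<in>R. r v *f v) \<in> ?B"
    unfolding basis_modulo_boundaries_def by blast+
  have disj: "Q \<inter> R = {}"
  proof (rule ccontr)
    assume "Q \<inter> R \<noteq> {}"
    then obtain w where w: "w \<in> Q" "w \<in> R" by auto
    have "(\<Sum>v\<in>R. (if v = w then 1 else 0) *f v) = (\<Sum>v\<in>R. if v = w then w else 0)"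
      by (intro sum.cong) (auto simp: fun_eq_iff)
    then have "(\<Sum>v\<in>R. (if v = w then 1 else 0) *f v) = w" using fin w by (simp add: sum.delta)
    moreover have "w \<in> ?B" using w(1) Q(3) fun_module.span_base by blast
    ultimately have "(\<Sum>v\<in>R. (if v = w then 1 else 0) *f v) \<in> ?B" by simp
    from ind[OF this w(2)] show False by simp
  qed
  have "fun_module.independent (Q \<union> R)"
  proof (rule fun_space.independent_if_scalars_zero)
    fix f v assume s: "(\<Sum>v\<in>Q \<union> R. f v *f v) = 0" and v: "v \<in> Q \<union> R"
    have s': "(\<Sum>v\<in>Q. f v *f v) + (\<Sum>v\<in>R. f v *f v) = 0"
      using s sum.union_disjoint[OF Q(1) fin disj] by metis
    have "(\<Sum>v\<in>Q. f v *f v) \<in> ?B"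
      unfolding Q(3)[symmetric] by (intro fun_module.span_sum fun_module.span_scale fun_module.span_base)
    moreover have "(\<Sum>v\<in>R. f v *f v) = - (\<Sum>v\<in>Q. f v *f v)" using s' by (simp add: add_eq_0_iff)
    ultimately have "(\<Sum>v\<in>R. f v *f v) \<in> ?B" using fun_module.subspace_neg[OF sub(2)] by metis
    then have fR: "f v = 0" if "v \<in> R" for v using ind that by blast
    then have "(\<Sum>v\<in>Q. f v *f v) = 0" using s' by simp
    then have "f v = 0" if "v \<in> Q" for v
      using fun_module.independentD[OF Q(2,1) order_refl] that by blast
    then show "f v = 0" using fR v by blast
  qed (use Q(1) fin in auto)
  moreover have "fun_module.span (Q \<union> R) = ?Z"
  proof
    have "Q \<subseteq> ?Z" using Q(3) B fun_module.span_superset by blast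
    then show "fun_module.span (Q \<union> R) \<subseteq> ?Z" using RZ sub(1) by (intro fun_module.span_minimal) auto
    show "?Z \<subseteq> fun_module.span (Q \<union> R)"
    proof
      fix z assume "z \<in> ?Z"
      then obtain r where "z - (\<Sum>v\<in>R. r v *f v) \<in> fun_module.span Q" using sp Q(3) by blast
      then have "z - (\<Sum>v\<in>R. r v *f v) \<in> fun_module.span (Q \<union> R)"
        using fun_module.span_mono[of Q "Q \<union> R"] by blast
      moreover have "(\<Sum>v\<in>R. r v *f v) \<in> fun_module.span (Q \<union> R)"
        by (intro fun_module.span_sum fun_module.span_scale fun_module.span_base) auto
      ultimately show "z \<in> fun_module.span (Q \<union> R)" using fun_module.span_add by fastforce
    qed
  qed
  ultimately show ?rhs using fin disj by blast
next
  let ?B = "boundaries X S k :: ('c \<Rightarrow> 'f) set" and ?Z = "cycles X S k :: ('c \<Rightarrow> 'f) set"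
  assume R: ?rhs
  then have fin: "finite R" and disj: "Q \<inter> R = {}" and ind: "fun_module.independent (Q \<union> R)"
    and sp: "fun_module.span (Q \<union> R) = ?Z" by auto
  have split: "(\<Sum>v\<in>Q \<union> R. f v *f v) = (\<Sum>v\<in>Q. f v *f v) + (\<Sum>v\<in>R. f v *f v)" for f
    by (rule sum.union_disjoint[OF Q(1) fin disj])
  show ?lhs
    unfolding basis_modulo_boundaries_def
  proof (intro conjI allI impI ballI)
    show "finite R" by (rule fin)
    show "R \<subseteq> ?Z" using sp fun_module.span_superset by blast
  next
    fix r v assume r: "(\<Sum>v\<in>R. r v *f v) \<in> ?B" and v: "v \<in> R"
    obtain q where q: "(\<Sum>v\<in>R. r v *f v) = (\<Sum>v\<in>Q. q v *f v)"
      using r unfolding Q(3)[symmetric] fun_module.span_finite[OF Q(1)] by auto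
    let ?f = "\<lambda>v. if v \<in> R then r v else - q v"
    have "(\<Sum>v\<in>Q. ?f v *f v) = (\<Sum>v\<in>Q. - (q v *f v))"
      using disj by (intro sum.cong) (auto simp: fun_eq_iff)
    moreover have "(\<Sum>v\<in>R. ?f v *f v) = (\<Sum>v\<in>R. r v *f v)" by (intro sum.cong) auto
    ultimately have "(\<Sum>v\<in>Q \<union> R. ?f v *f v) = 0" by (simp add: split q sum_negf)
    from fun_module.independentD[OF ind _ order_refl this, of v] v Q(1) fin show "r v = 0" by simp
  next
    fix z assume "z \<in> ?Z"
    then obtain f where "z = (\<Sum>v\<in>Q \<union> R. f v *f v)"
      unfolding sp[symmetric] using fun_module.span_finite[of "Q \<union> R"] Q(1) fin by auto
    then have "z - (\<Sum>v\<in>R. f v *f v) = (\<Sum>v\<in>Q. f v *f v)" by (simp add: split)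
    moreover have "(\<Sum>v\<in>Q. f v *f v) \<in> ?B"
      unfolding Q(3)[symmetric] by (intro fun_module.span_sum fun_module.span_scale fun_module.span_base)
    ultimately show "\<exists>r. z - (\<Sum>v\<in>R. r v *f v) \<in> ?B"
      by (intro exI[of _ f]) simp
  qed
qed

lemma cell_chains_finite_span:
  assumes "finite (cells_in X S k)"
  shows "\<exists>D. finite D \<and> cell_chains X S k \<subseteq> fun_module.span (D :: ('c \<Rightarrow> 'f::field) set)"
proof (intro exI conjI)
  let ?u = "\<lambda>e. (\<lambda>f. if f = e then 1 else 0) :: 'c \<Rightarrow> 'f"
  show "finite (?u ` cells_in X S k)" using assms by simp
  show "cell_chains X S k \<subseteq> fun_module.span (?u ` cells_in X S k)"
  proof
    fix c :: "'c \<Rightarrow> 'f" assume c: "c \<in> cell_chains X S k"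
    have "c = (\<Sum>e\<in>cells_in X S k. c e *f ?u e)"
    proof
      fix f
      have "(\<Sum>e\<in>cells_in X S k. c e *f ?u e) f = (\<Sum>e\<in>cells_in X S k. if e = f then c f else 0)"
        unfolding sum_apply by (intro sum.cong) auto
      then show "c f = (\<Sum>e\<in>cells_in X S k. c e *f ?u e) f"
        using assms c by (simp add: sum.delta cell_chains_def)
    qed
    also have "\<dots> \<in> fun_module.span (?u ` cells_in X S k)"
      by (intro fun_module.span_sum fun_module.span_scale fun_module.span_base) auto
    finally show "c \<in> fun_module.span (?u ` cells_in X S k)" .
  qed
qed

text \<open>The rank formula \<open>\<beta> + dim B = dim Z\<close>. It also shows that the definite description defining the Betti
  number denotes: a basis exists by extension, and all bases have the same cardinality.\<close>

theorem betti_add_card: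
  fixes Q :: "('c \<Rightarrow> rat) set"
  assumes fin: "finite (cells_in X S k)" and B: "boundaries X S k \<subseteq> (cycles X S k :: ('c \<Rightarrow> rat) set)"
    and Q: "finite Q" "fun_module.independent Q" "fun_module.span Q = boundaries X S k"
    and P: "fun_module.independent P" "fun_module.span P = (cycles X S k :: ('c \<Rightarrow> rat) set)"
  shows "betti X S k + card Q = card P"
proof -
  obtain D :: "('c \<Rightarrow> rat) set" where D: "finite D" "cell_chains X S k \<subseteq> fun_module.span D"
    using cell_chains_finite_span[OF fin] by blast
  have Z: "cycles X S k \<subseteq> fun_module.span D" using D(2) by (auto simp: cycles_def)
  have card_eq: "card T = card P"
    if "fun_module.independent T" "fun_module.span T = (cycles X S k :: ('c \<Rightarrow> rat) set)" for T
    using fun_space.dim_eq_card[of T P] fun_space.dim_eq_card[of P P] that P by metis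
  have "Q \<subseteq> cycles X S k" using Q(3) B fun_module.span_superset by blast
  then obtain T where T: "Q \<subseteq> T" "T \<subseteq> cycles X S k" "fun_module.independent T" "cycles X S k \<subseteq> fun_module.span T"
    using fun_space.maximal_independent_subset_extend[OF _ Q(2)] by blast
  have T_span: "fun_module.span T = cycles X S k"
    using T fun_module.span_minimal[OF T(2) subspace_cycles] by blast
  have T_fin: "finite T"
    using fun_space.independent_span_bound[OF D(1) T(3)] T(2) Z by blast
  have R: "basis_modulo_boundaries X S k (T - Q)"
    unfolding basis_modulo_boundaries_iff[OF B Q] using T T_span T_fin by (auto simp: Un_absorb1)
  have any: "card A + card Q = card P" if A: "homology_basis X S k (A :: ('c \<Rightarrow> rat) set set)" for A
  proof -
    obtain R :: "('c \<Rightarrow> rat) set" where R: "basis_modulo_boundaries X S k R" "card R = card A"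
      using homology_basis_imp_basis_modulo_boundaries[OF B A] .
    then have R': "finite R" "Q \<inter> R = {}" "fun_module.independent (Q \<union> R)" "fun_module.span (Q \<union> R) = cycles X S k"
      unfolding basis_modulo_boundaries_iff[OF B Q] by auto
    from card_eq[OF R'(3,4)] show ?thesis using R(2) card_Un_disjoint[OF Q(1) R'(1,2)] by simp
  qed
  let ?A = "translate (boundaries X S k) ` (T - Q)"
  have hb: "homology_basis X S k ?A" by (rule basis_modulo_boundaries_imp_homology_basis(1)[OF B R])
  have "betti X S k = card ?A"
    unfolding betti_def
  proof (rule the_equality)
    show "\<exists>A :: ('c \<Rightarrow> rat) set set. homology_basis X S k A \<and> card A = card ?A" using hb by blast
    show "n = card ?A" if "\<exists>A :: ('c \<Rightarrow> rat) set set. homology_basis X S k A \<and> card A = n" for n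
      using that any any[OF hb] by (metis add_right_cancel)
  qed
  then show ?thesis using any[OF hb] by simp
qed

section \<open>Co-trees as complements of the boundaries\<close>

text \<open>The rational chains on the \<open>k\<close>-cells of \<open>S\<close> and the boundaries together span all \<open>k\<close>-chains, and
  they meet only in zero. Equivalently, the \<open>k\<close>-cells of \<open>S\<close> form a basis of the matroid that the unit chains
  represent in the quotient of all chains by the boundaries.\<close>

definition boundary_complement :: "('a, 'c) cw \<Rightarrow> int \<Rightarrow> 'c set \<Rightarrow> bool" where
  "boundary_complement X k S \<longleftrightarrow>
     (\<forall>c :: 'c \<Rightarrow> rat. c \<in> cell_chains X S k \<longrightarrow> c \<in> boundaries X (cells X) k \<longrightarrow> c = 0) \<and>
     (\<forall>c :: 'c \<Rightarrow> rat. c \<in> cell_chains X (cells X) k \<longrightarrow> (\<exists>t\<in>cell_chains X S k. c - t \<in> boundaries X (cells X) k))"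

lemma nested_bases:
  fixes B B' :: "('c \<Rightarrow> rat) set"
  assumes sub: "fun_module.subspace B" "fun_module.subspace B'" "B \<subseteq> B'" and fin: "B' \<subseteq> fun_module.span D" "finite D"
  obtains Q Q' where "finite Q'" "Q \<subseteq> Q'" "fun_module.independent Q" "fun_module.independent Q'"
    "fun_module.span Q = B" "fun_module.span Q' = B'"
proof -
  have emp: "fun_module.independent ({} :: ('c \<Rightarrow> rat) set)" by (rule fun_module.independent_empty)
  obtain Q where "{} \<subseteq> Q" and Q: "Q \<subseteq> B" "fun_module.independent Q" "B \<subseteq> fun_module.span Q"
    by (rule fun_space.maximal_independent_subset_extend[OF empty_subsetI emp, of B])
  obtain Q' where Q': "Q \<subseteq> Q'" "Q' \<subseteq> B'" "fun_module.independent Q'" "B' \<subseteq> fun_module.span Q'"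
    by (rule fun_space.maximal_independent_subset_extend[OF order_trans[OF Q(1) sub(3)] Q(2)])
  have "finite Q'"
    using fun_space.independent_span_bound[OF fin(2) Q'(3) order_trans[OF Q'(2) fin(1)]] by (rule conjunct1)
  moreover have "fun_module.span Q = B" using fun_module.span_minimal[OF Q(1) sub(1)] Q(3) by (rule subset_antisym)
  moreover have "fun_module.span Q' = B'" using fun_module.span_minimal[OF Q'(2) sub(2)] Q'(4) by (rule subset_antisym)
  ultimately show ?thesis using that[of Q' Q] Q(2) Q'(1,3) by simp
qed

context
  fixes X :: "('a, 'c) cw" and d :: int
  assumes X: "finite_cw X"
begin

lemma skeleton_sandwich_cells:
  assumes "skel X (d - 2) \<subseteq> L" "L \<subseteq> skel X (d - 1)"
  shows "L \<subseteq> cells X" "cells_in X L (d - 2) = cells_in X (cells X) (d - 2)"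
    "L = skel X (d - 2) \<union> cells_in X L (d - 1)"
proof -
  show "L \<subseteq> cells X" using assms(2) by (auto simp: skel_def)
  then show "cells_in X L (d - 2) = cells_in X (cells X) (d - 2)"
    using assms by (auto simp: cells_in_def skel_def)
  show "L = skel X (d - 2) \<union> cells_in X L (d - 1)"
    using assms by (force simp: cells_in_def skel_def)
qed

lemma subcomplex_sandwich:
  assumes "skel X (d - 2) \<subseteq> L" "L \<subseteq> skel X (d - 1)"
  shows "subcomplex X L"
proof -
  let ?J = "cells_in X L (d - 1)"
  note L = skeleton_sandwich_cells[OF assms]
  have "subcomplex X (skel X (d - 2) \<union> ?J)"
  proof (rule subcomplex_attach[OF subcomplex_skel[OF X]])
    show "?J \<subseteq> cells X" using L(1) by (auto simp: cells_in_def)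
    fix e assume e: "e \<in> ?J"
    then have dim: "d - 2 = int (cdim X e) - 1" and "e \<in> cells X"
      using L(1) by (auto simp: cells_in_def)
    from finite_cwD(7)[OF X this(2)]
    show "charmap X e ` disc_boundary (cdim X e) \<subseteq> points X (skel X (d - 2))"
      unfolding dim .
  qed
  then show ?thesis using L(3) by simp
qed

lemma boundaries_sandwich_top:
  assumes "L \<subseteq> skel X (d - 1)"
  shows "boundaries X L (d - 1) = ({0} :: ('c \<Rightarrow> 'f::comm_ring_1) set)"
proof -
  have "cells_in X L d = {}" using assms by (auto simp: cells_in_def skel_def)
  then have "cell_chains X L d = ({0} :: ('c \<Rightarrow> 'f) set)" by (auto simp: cell_chains_def fun_eq_iff)
  then show ?thesis by (simp add: boundaries_def bd_0)
qed

lemma cycles_sandwich_bottom: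
  assumes "skel X (d - 2) \<subseteq> L" "L \<subseteq> skel X (d - 1)"
  shows "cycles X L (d - 2) = (cycles X (cells X) (d - 2) :: ('c \<Rightarrow> 'f::comm_ring_1) set)"
  using skeleton_sandwich_cells(2)[OF assms] by (simp add: cycles_def cell_chains_def)

text \<open>In degree \<open>d - 2\<close> the complexes \<open>L\<close> and \<open>X\<close> have the same cycles, and the boundaries of \<open>L\<close>
  are among those of \<open>X\<close>. Equal Betti numbers give equal dimensions, hence equal boundaries.\<close>

lemma boundaries_bottom_eq:
  assumes L: "skel X (d - 2) \<subseteq> L" "L \<subseteq> skel X (d - 1)"
    and betti: "betti X L (d - 2) = betti X (cells X) (d - 2)"
  shows "boundaries X L (d - 2) = (boundaries X (cells X) (d - 2) :: ('c \<Rightarrow> rat) set)"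
proof -
  let ?k = "d - 2"
  note LL = skeleton_sandwich_cells[OF L]
  have Z: "cycles X L ?k = (cycles X (cells X) ?k :: ('c \<Rightarrow> rat) set)" by (rule cycles_sandwich_bottom[OF L])
  have BL: "boundaries X L ?k \<subseteq> (cycles X L ?k :: ('c \<Rightarrow> rat) set)"
    by (rule boundaries_subset_cycles[OF X LL(2)])
  have BX: "boundaries X (cells X) ?k \<subseteq> (cycles X (cells X) ?k :: ('c \<Rightarrow> rat) set)"
    by (rule boundaries_subset_cycles[OF X refl])
  have mono: "boundaries X L ?k \<subseteq> (boundaries X (cells X) ?k :: ('c \<Rightarrow> rat) set)"
    by (rule boundaries_mono[OF LL(1)])
  obtain D :: "('c \<Rightarrow> rat) set" where D: "finite D" "cell_chains X (cells X) ?k \<subseteq> fun_module.span D"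
    using cell_chains_finite_span[OF finite_cells_in[OF X]] by blast
  have Zspan: "(cycles X (cells X) ?k :: ('c \<Rightarrow> rat) set) \<subseteq> fun_module.span D"
    using D(2) by (auto simp: cycles_def)
  then have "(boundaries X (cells X) ?k :: ('c \<Rightarrow> rat) set) \<subseteq> fun_module.span D" by (rule order_trans[OF BX])
  note Bspan = this
  obtain Q Q' :: "('c \<Rightarrow> rat) set" where Q: "finite Q'" "Q \<subseteq> Q'" "fun_module.independent Q" "fun_module.independent Q'"
    "fun_module.span Q = boundaries X L ?k" "fun_module.span Q' = boundaries X (cells X) ?k"
    by (rule nested_bases[OF subspace_boundaries subspace_boundaries mono Bspan D(1)])
  obtain P' P :: "('c \<Rightarrow> rat) set" where "finite P" "P' \<subseteq> P" "fun_module.independent P'"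
    and P: "fun_module.independent P" and "fun_module.span P' = cycles X (cells X) ?k"
    and P': "fun_module.span P = cycles X (cells X) ?k"
    by (rule nested_bases[OF subspace_cycles subspace_cycles order_refl Zspan D(1)])
  have "betti X L ?k + card Q = card P"
    by (rule betti_add_card[OF _ BL finite_subset[OF Q(2,1)] Q(3,5) P])
      (simp_all add: LL(2) finite_cells_in[OF X] P' Z)
  moreover have "betti X (cells X) ?k + card Q' = card P"
    by (rule betti_add_card[OF finite_cells_in[OF X] BX Q(1,4,6) P P'])
  ultimately have "card Q = card Q'" using betti by simp
  then have "Q = Q'" using card_subset_eq[OF Q(1,2)] by simp
  then show ?thesis using Q by simp
qed

lemma homology_sandwich_top:
  assumes "L \<subseteq> skel X (d - 1)"
  shows "carrier (homology X L (d - 1)) = ((\<lambda>z. {z}) ` cycles X L (d - 1) :: ('c \<Rightarrow> 'f::comm_ring_1) set set)"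
  by (simp add: carrier_homology boundaries_sandwich_top[OF assms] translate_def)

lemma incl_map_sandwich_top:
  assumes "L \<subseteq> skel X (d - 1)"
  shows "incl_map X (d - 1) {z} = translate (boundaries X (cells X) (d - 1)) (z :: 'c \<Rightarrow> 'f::comm_ring_1)"
proof -
  have "L \<subseteq> cells X" using assms by (auto simp: skel_def)
  from incl_map_translate[OF this, of "d - 1" z] show ?thesis
    by (simp add: boundaries_sandwich_top[OF assms] translate_def)
qed

text \<open>Since \<open>L\<close> has no \<open>d\<close>-cells, injectivity of the map on homology says that no nonzero cycle of \<open>L\<close> bounds
  in \<open>X\<close>, and chains that bound are cycles. For spanning, the boundary of a chain is also the boundary of a
  chain of \<open>L\<close>; the difference is a cycle, and surjectivity on homology moves it into \<open>L\<close> up to a boundary.\<close>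

lemma cotree_imp_boundary_complement:
  assumes "cotree X d L"
  shows "boundary_complement X (d - 1) L"
proof -
  let ?B = "boundaries X (cells X) (d - 1) :: ('c \<Rightarrow> rat) set"
  have L: "skel X (d - 2) \<subseteq> L" "L \<subseteq> skel X (d - 1)"
    and betti: "betti X L (d - 2) = betti X (cells X) (d - 2)"
    and iso: "incl_map X (d - 1) \<in> iso (homology X L (d - 1) :: ('c \<Rightarrow> rat) set monoid) (homology X (cells X) (d - 1))"
    using assms by (auto simp: cotree_def)
  have sub: "fun_module.subspace ?B" by (rule subspace_boundaries)
  have BZ: "?B \<subseteq> cycles X (cells X) (d - 1)" by (rule boundaries_subset_cycles[OF X refl])
  note top = homology_sandwich_top[OF L(2), where 'f = rat] incl_map_sandwich_top[OF L(2), where 'f = rat]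
  have bij: "bij_betw (incl_map X (d - 1)) ((\<lambda>z. {z}) ` (cycles X L (d - 1) :: ('c \<Rightarrow> rat) set))
      (translate ?B ` cycles X (cells X) (d - 1))"
    using iso[unfolded iso_def, unfolded top(1), unfolded carrier_homology] by simp
  have inj: "z = z'" if "z \<in> cycles X L (d - 1)" "z' \<in> cycles X L (d - 1)" "z - z' \<in> ?B" for z z'
  proof -
    have "inj_on (incl_map X (d - 1)) ((\<lambda>z. {z}) ` (cycles X L (d - 1) :: ('c \<Rightarrow> rat) set))"
      by (rule bij_betw_imp_inj_on[OF bij])
    moreover have "incl_map X (d - 1) {z} = incl_map X (d - 1) {z'}"
      unfolding top(2) using that(3) by (simp add: translate_eq_iff[OF sub])
    ultimately have "{z} = {z'}" using that by (auto dest: inj_onD)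
    then show ?thesis by simp
  qed
  have surj: "\<exists>z'\<in>cycles X L (d - 1). z - z' \<in> ?B" if z: "z \<in> cycles X (cells X) (d - 1)" for z
  proof -
    have "translate ?B z \<in> incl_map X (d - 1) ` (\<lambda>z. {z}) ` (cycles X L (d - 1) :: ('c \<Rightarrow> rat) set)"
      unfolding bij_betw_imp_surj_on[OF bij] using z by (rule imageI)
    then show ?thesis by (auto simp: top(2) translate_eq_iff[OF sub])
  qed
  have bot: "boundaries X L (d - 2) = (boundaries X (cells X) (d - 2) :: ('c \<Rightarrow> rat) set)"
    by (rule boundaries_bottom_eq[OF L betti])
  show ?thesis
    unfolding boundary_complement_def
  proof (intro conjI allI impI)
    fix c assume c: "c \<in> cell_chains X L (d - 1)" "c \<in> ?B"
    then have "c \<in> cycles X L (d - 1)" using BZ by (auto simp: cycles_def)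
    from inj[OF this fun_module.subspace_0[OF subspace_cycles]] c(2) show "c = 0" by simp
  next
    fix c :: "'c \<Rightarrow> rat" assume c: "c \<in> cell_chains X (cells X) (d - 1)"
    have dd: "d - 2 + 1 = d - 1" by simp
    have "bd X (d - 1) c \<in> boundaries X L (d - 2)"
      unfolding bot unfolding boundaries_def dd using c by blast
    then obtain t where t: "t \<in> cell_chains X L (d - 1)" "bd X (d - 1) c = bd X (d - 1) t"
      unfolding boundaries_def dd by blast
    have "t \<in> cell_chains X (cells X) (d - 1)"
      using t(1) cell_chains_mono[OF skeleton_sandwich_cells(1)[OF L]] by blast
    then have "c - t \<in> cycles X (cells X) (d - 1)"
      using fun_module.subspace_diff[OF subspace_cell_chains c] t(2) by (simp add: cycles_def bd_diff zero_fun_eq)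
    from surj[OF this] obtain z where z: "z \<in> cycles X L (d - 1)" "c - t - z \<in> ?B" by blast
    have "t + z \<in> cell_chains X L (d - 1)"
      using fun_module.subspace_add[OF subspace_cell_chains t(1)] z(1) by (auto simp: cycles_def)
    moreover have "c - (t + z) \<in> ?B" using z(2) by (simp add: diff_diff_eq)
    ultimately show "\<exists>t\<in>cell_chains X L (d - 1). c - t \<in> ?B" by blast
  qed
qed

text \<open>Each boundary has boundary zero. So removing the boundary part of a cycle leaves a cycle of \<open>L\<close>, which gives
  surjectivity, and removing it from a chain does not change the boundary of the chain, so that in degree \<open>d - 2\<close>
  the homology of \<open>L\<close> and of \<open>X\<close> is literally the same group.\<close>

lemma boundary_complement_imp_cotree:
  assumes L: "skel X (d - 2) \<subseteq> L" "L \<subseteq> skel X (d - 1)" and comp: "boundary_complement X (d - 1) L"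
  shows "cotree X d L"
proof -
  let ?B = "boundaries X (cells X) (d - 1) :: ('c \<Rightarrow> rat) set"
  have sub: "fun_module.subspace ?B" by (rule subspace_boundaries)
  have BZ: "?B \<subseteq> cycles X (cells X) (d - 1)" by (rule boundaries_subset_cycles[OF X refl])
  note LL = skeleton_sandwich_cells[OF L]
  note top = homology_sandwich_top[OF L(2), where 'f = rat] incl_map_sandwich_top[OF L(2), where 'f = rat]
  have meet: "\<And>c. c \<in> cell_chains X L (d - 1) \<Longrightarrow> c \<in> ?B \<Longrightarrow> c = 0"
    and span: "\<And>c. c \<in> cell_chains X (cells X) (d - 1) \<Longrightarrow> \<exists>t\<in>cell_chains X L (d - 1). c - t \<in> ?B"
    using comp by (auto simp: boundary_complement_def)
  have ZL: "cycles X L (d - 1) \<subseteq> (cycles X (cells X) (d - 1) :: ('c \<Rightarrow> rat) set)" by (rule cycles_mono[OF LL(1)])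
  have surj: "\<exists>z'\<in>cycles X L (d - 1). z - z' \<in> ?B" if z: "z \<in> cycles X (cells X) (d - 1)" for z
  proof -
    obtain t where t: "t \<in> cell_chains X L (d - 1)" "z - t \<in> ?B" using span[of z] z by (auto simp: cycles_def)
    have "bd X (d - 1) (z - t) = 0" using t(2) BZ by (auto simp: cycles_def zero_fun_eq)
    then have "bd X (d - 1) t = 0" using z by (simp add: cycles_def zero_fun_eq bd_diff)
    then show ?thesis using t by (auto simp: cycles_def zero_fun_eq)
  qed
  have hom: "incl_map X (d - 1) \<in> hom (homology X L (d - 1) :: ('c \<Rightarrow> rat) set monoid) (homology X (cells X) (d - 1))"
  proof (rule homI)
    fix h h' assume h: "h \<in> carrier (homology X L (d - 1) :: ('c \<Rightarrow> rat) set monoid)" "h' \<in> carrier (homology X L (d - 1) :: ('c \<Rightarrow> rat) set monoid)"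
    then obtain z z' where z: "z \<in> cycles X L (d - 1)" "z' \<in> cycles X L (d - 1)" "h = {z}" "h' = {z'}"
      unfolding top(1) by blast
    show "incl_map X (d - 1) h \<in> carrier (homology X (cells X) (d - 1))"
      using z ZL by (auto simp: top(2) carrier_homology)
    have m: "h \<otimes>\<^bsub>homology X L (d - 1)\<^esub> h' = {z + z'}"
      by (simp add: homology_def set_mult_additive_group z)
    have "translate ?B (z + z') = translate ?B z <#>\<^bsub>additive_group (cycles X (cells X) (d - 1))\<^esub> translate ?B z'"
      using hom_mult[OF translate_hom[OF subspace_cycles sub BZ], of z z'] z ZL
      by (auto simp: mult_additive_group)
    then show "incl_map X (d - 1) (h \<otimes>\<^bsub>homology X L (d - 1)\<^esub> h') =
      incl_map X (d - 1) h \<otimes>\<^bsub>homology X (cells X) (d - 1)\<^esub> incl_map X (d - 1) h'"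
      unfolding m unfolding z(3,4) top(2) by (simp add: homology_def)
  qed
  have "inj_on (incl_map X (d - 1)) ((\<lambda>z. {z}) ` (cycles X L (d - 1) :: ('c \<Rightarrow> rat) set))"
  proof (rule inj_onI)
    fix h h' assume h: "h \<in> (\<lambda>z. {z}) ` (cycles X L (d - 1) :: ('c \<Rightarrow> rat) set)"
      "h' \<in> (\<lambda>z. {z}) ` (cycles X L (d - 1) :: ('c \<Rightarrow> rat) set)" "incl_map X (d - 1) h = incl_map X (d - 1) h'"
    then obtain z z' where z: "z \<in> cycles X L (d - 1)" "z' \<in> cycles X L (d - 1)" "h = {z}" "h' = {z'}" by blast
    then have "z - z' \<in> ?B" using h(3) by (simp add: top(2) translate_eq_iff[OF sub])
    moreover have "z - z' \<in> cell_chains X L (d - 1)"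
      using fun_module.subspace_diff[OF subspace_cycles z(1,2)] by (simp add: cycles_def)
    ultimately have "z - z' = 0" using meet by blast
    then show "h = h'" using z by simp
  qed
  moreover have "incl_map X (d - 1) ` (\<lambda>z. {z}) ` (cycles X L (d - 1) :: ('c \<Rightarrow> rat) set)
      = translate ?B ` cycles X (cells X) (d - 1)"
  proof (intro subset_antisym subsetI)
    fix h assume "h \<in> translate ?B ` cycles X (cells X) (d - 1)"
    then obtain z where z: "z \<in> cycles X (cells X) (d - 1)" "h = translate ?B z" by auto
    from surj[OF z(1)] obtain z' where "z' \<in> cycles X L (d - 1)" "z - z' \<in> ?B" by blast
    then have "h = incl_map X (d - 1) {z'}" unfolding z(2) top(2) by (simp add: translate_eq_iff[OF sub])
    then show "h \<in> incl_map X (d - 1) ` (\<lambda>z. {z}) ` (cycles X L (d - 1) :: ('c \<Rightarrow> rat) set)"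
      using \<open>z' \<in> cycles X L (d - 1)\<close> by blast
  qed (use ZL in \<open>auto simp: top(2)\<close>)
  ultimately have iso: "incl_map X (d - 1) \<in> iso (homology X L (d - 1) :: ('c \<Rightarrow> rat) set monoid) (homology X (cells X) (d - 1))"
    using hom unfolding iso_def bij_betw_def top(1) unfolding carrier_homology by simp
  have dd: "d - 2 + 1 = d - 1" by simp
  have bot: "boundaries X L (d - 2) = (boundaries X (cells X) (d - 2) :: ('c \<Rightarrow> rat) set)"
  proof
    show "boundaries X (cells X) (d - 2) \<subseteq> (boundaries X L (d - 2) :: ('c \<Rightarrow> rat) set)"
    proof
      fix b :: "'c \<Rightarrow> rat" assume "b \<in> boundaries X (cells X) (d - 2)"
      then obtain c where c: "c \<in> cell_chains X (cells X) (d - 1)" "b = bd X (d - 1) c"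
        unfolding boundaries_def dd by blast
      obtain t where t: "t \<in> cell_chains X L (d - 1)" "c - t \<in> ?B" using span[OF c(1)] by blast
      have "bd X (d - 1) (c - t) = 0" using t(2) BZ by (auto simp: cycles_def zero_fun_eq)
      then have "b = bd X (d - 1) t" using c(2) by (simp add: bd_diff)
      then show "b \<in> boundaries X L (d - 2)" unfolding boundaries_def dd using t(1) by blast
    qed
  qed (rule boundaries_mono[OF LL(1)])
  have Z: "cycles X L (d - 2) = (cycles X (cells X) (d - 2) :: ('c \<Rightarrow> rat) set)"
    by (rule cycles_sandwich_bottom[OF L])
  have "(homology_basis X L (d - 2) :: ('c \<Rightarrow> rat) set set \<Rightarrow> bool) = homology_basis X (cells X) (d - 2)"
    unfolding homology_basis_def homology_def homology_scale_def[abs_def] bot Z by (rule refl)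
  then have "betti X L (d - 2) = betti X (cells X) (d - 2)" by (simp add: betti_def)
  then show ?thesis
    unfolding cotree_def using subcomplex_sandwich[OF L] iso L by blast
qed

lemma cotree_iff:
  "cotree X d L \<longleftrightarrow> skel X (d - 2) \<subseteq> L \<and> L \<subseteq> skel X (d - 1) \<and> boundary_complement X (d - 1) L"
  using cotree_imp_boundary_complement boundary_complement_imp_cotree unfolding cotree_def by blast

end

section \<open>Exchange and uniqueness of the minimal co-tree\<close>

abbreviation (input) unit_chain :: "'c \<Rightarrow> 'c \<Rightarrow> 'f::comm_ring_1" where
  "unit_chain b \<equiv> (\<lambda>e. if e = b then 1 else 0)"

context
  fixes X :: "('a, 'c) cw" and d :: int
  assumes X: "finite_cw X"
begin

text \<open>The exchange property of matroid bases. The unit chain at \<open>b\<close> agrees modulo boundaries with a chain \<open>t\<close> of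
  \<open>L2\<close>. Some cell \<open>f\<close> of \<open>t\<close> lies outside \<open>L1\<close>, for otherwise a nonzero chain of \<open>L1\<close> would be a
  boundary; that \<open>f\<close> can be replaced by \<open>b\<close>.\<close>

lemma cotree_exchange:
  assumes L1: "cotree X d L1" and L2: "cotree X d L2" and b: "b \<in> L1" "b \<notin> L2"
  obtains f where "f \<in> L2" "f \<notin> L1" "cotree X d (insert b (L2 - {f}))"
proof -
  let ?k = "d - 1"
  let ?B = "boundaries X (cells X) ?k :: ('c \<Rightarrow> rat) set"
  have B: "fun_module.subspace ?B" by (rule subspace_boundaries)
  have s1: "skel X (d - 2) \<subseteq> L1" "L1 \<subseteq> skel X ?k" "boundary_complement X ?k L1"
    and s2: "skel X (d - 2) \<subseteq> L2" "L2 \<subseteq> skel X ?k" "boundary_complement X ?k L2"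
    using L1 L2 unfolding cotree_iff[OF X] by blast+
  have meet1: "\<And>c. c \<in> cell_chains X L1 ?k \<Longrightarrow> c \<in> ?B \<Longrightarrow> c = 0"
    using s1(3) by (simp add: boundary_complement_def)
  have meet2: "\<And>c. c \<in> cell_chains X L2 ?k \<Longrightarrow> c \<in> ?B \<Longrightarrow> c = 0"
    and span2: "\<And>c. c \<in> cell_chains X (cells X) ?k \<Longrightarrow> \<exists>t\<in>cell_chains X L2 ?k. c - t \<in> ?B"
    using s2(3) by (simp_all add: boundary_complement_def)
  have dim_b: "int (cdim X b) = ?k" "b \<in> cells X"
  proof -
    have "b \<in> skel X ?k" "b \<notin> skel X (d - 2)" using b s1(2) s2(1) by auto
    then show "int (cdim X b) = ?k" "b \<in> cells X" by (auto simp: skel_def)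
  qed
  have ub: "unit_chain b \<in> cell_chains X L1 ?k" "unit_chain b \<in> cell_chains X (cells X) ?k"
    using b dim_b by (auto simp: cell_chains_def cells_in_def)
  obtain t where t: "t \<in> cell_chains X L2 ?k" "unit_chain b - t \<in> ?B" using span2[OF ub(2)] by blast
  have tb: "t b = 0" using t(1) b(2) by (simp add: cell_chains_def cells_in_def)
  obtain f where f: "t f \<noteq> 0" "f \<notin> L1"
  proof (rule ccontr)
    assume "\<not> thesis"
    then have "t \<in> cell_chains X L1 ?k"
      using t(1) that by (auto simp: cell_chains_def cells_in_def)
    then have "unit_chain b - t = 0"
      by (intro meet1[OF _ t(2)] fun_module.subspace_diff[OF subspace_cell_chains] ub)
    from fun_cong[OF this, of b] tb show False by simp
  qed
  have f2: "f \<in> L2" "int (cdim X f) = ?k" "f \<noteq> b" using t(1) f(1) tb by (auto simp: cell_chains_def cells_in_def)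
  let ?L = "insert b (L2 - {f})"
  have comp: "boundary_complement X ?k ?L"
    unfolding boundary_complement_def
  proof (intro conjI allI impI)
    fix c :: "'c \<Rightarrow> rat" assume c: "c \<in> cell_chains X ?L ?k" "c \<in> ?B"
    \<comment> \<open>Subtracting the multiple \<open>c b\<close> of the boundary relating \<open>b\<close> to \<open>t\<close> turns \<open>c\<close> into a chain
       of \<open>L2\<close>; that chain is a boundary, hence zero, and its coefficient at \<open>f\<close> is \<open>c b * t f\<close>.\<close>
    let ?c = "c - c b *f (unit_chain b - t)"
    have "?c \<in> ?B"
      by (intro fun_module.subspace_diff[OF B] c(2) fun_module.subspace_scale[OF B] t(2))
    moreover have "?c \<in> cell_chains X L2 ?k"
      using c(1) t(1) by (auto simp: cell_chains_def cells_in_def)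
    ultimately have z: "?c = 0" by (intro meet2)
    have "c f = 0" using c(1) f2(3) by (simp add: cell_chains_def cells_in_def)
    then have "c b = 0" using fun_cong[OF z, of f] f f2(3) by simp
    then show "c = 0" using z by (simp add: fun_eq_iff)
  next
    fix c :: "'c \<Rightarrow> rat" assume "c \<in> cell_chains X (cells X) ?k"
    then obtain s where s: "s \<in> cell_chains X L2 ?k" "c - s \<in> ?B" using span2 by blast
    let ?r = "s f / t f"
    let ?s = "s + ?r *f (unit_chain b - t)"
    have "?s \<in> cell_chains X ?L ?k"
      using s(1) t(1) b dim_b f(1) tb f2 by (auto simp: cell_chains_def cells_in_def)
    moreover have "c - s - ?r *f (unit_chain b - t) \<in> ?B"
      by (intro fun_module.subspace_diff[OF B] s(2) fun_module.subspace_scale[OF B] t(2))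
    then have "c - ?s \<in> ?B" by (simp add: diff_diff_eq)
    ultimately show "\<exists>t\<in>cell_chains X ?L ?k. c - t \<in> ?B" by blast
  qed
  have "cotree X d ?L"
    unfolding cotree_iff[OF X] using s1 s2 b f2 comp by (auto simp: skel_def)
  then show ?thesis using that f2(1) f(2) by blast
qed

lemma finite_cotrees: "finite (Collect (cotree X d))"
proof (rule finite_subset)
  show "Collect (cotree X d) \<subseteq> Pow (cells X)" by (auto simp: cotree_def subcomplex_def)
  show "finite (Pow (cells X))" using finite_cwD(2)[OF X] by simp
qed

text \<open>A co-tree \<open>L\<close> that is no dearer than the minimal one is minimal too, so in the cheapest cell on which
  the two differ, either of them could be improved by an exchange. Injectivity of \<open>E\<close> makes the improvement strict.\<close>

theorem minimal_cotree_strict: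
  assumes inj: "inj_on E (cells_in X (cells X) (d - 1))" and M: "minimal_cotree X d E M"
    and L: "cotree X d L" "L \<noteq> M"
  shows "(\<Sum>b\<in>cells_in X M (d - 1). E b) < (\<Sum>b\<in>cells_in X L (d - 1). E b :: real)"
proof -
  let ?k = "d - 1"
  let ?w = "\<lambda>L. \<Sum>b\<in>cells_in X L ?k. E b"
  have M': "cotree X d M" and min: "\<And>L. cotree X d L \<Longrightarrow> ?w M \<le> ?w L"
    using M by (auto simp: minimal_cotree_def is_arg_min_def not_less)
  have fin: "finite (cells_in X L ?k)" if "cotree X d L" for L
    using that finite_cwD(2)[OF X] finite_subset by (fastforce simp: cotree_def subcomplex_def cells_in_def)
  have sand: "skel X (d - 2) \<subseteq> L" "L \<subseteq> skel X ?k" if "cotree X d L" for L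
    using that by (auto simp: cotree_def)
  have top: "e \<in> cells_in X (cells X) ?k" if "cotree X d L" "cotree X d L'" "e \<in> L" "e \<notin> L'" for L L' e
    using sand[OF that(1)] sand[OF that(2)] that(3,4) by (force simp: skel_def cells_in_def)
  have swap: "?w (insert b (T - {f})) = ?w T - E f + E b"
    if "cotree X d T" "b \<in> cells_in X (cells X) ?k" "b \<notin> T" "f \<in> cells_in X (cells X) ?k" "f \<in> T" for T b f
  proof -
    have "cells_in X (insert b (T - {f})) ?k = insert b (cells_in X T ?k - {f})"
      using that by (auto simp: cells_in_def)
    moreover have "f \<in> cells_in X T ?k" "b \<notin> cells_in X T ?k" using that by (auto simp: cells_in_def)
    ultimately show ?thesis using fin[OF that(1)] by (simp add: sum_diff1)
  qed
  show ?thesis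
  proof (rule ccontr)
    assume "\<not> ?thesis"
    then have le: "?w L \<le> ?w M" by simp
    let ?D = "(L - M) \<union> (M - L)"
    have DC: "?D \<subseteq> cells_in X (cells X) ?k" using top[OF L(1) M'] top[OF M' L(1)] by blast
    then have finD: "finite ?D" using finite_cells_in[OF X] finite_subset by blast
    have "?D \<noteq> {}" using L(2) by blast
    then obtain b where b: "b \<in> ?D" "\<And>e. e \<in> ?D \<Longrightarrow> E b \<le> E e"
      using finD by (metis arg_min_if_finite(1) arg_min_least)
    have lt: "E b < E f" if "f \<in> ?D" "f \<noteq> b" for f
    proof -
      have "E b \<noteq> E f" using inj_onD[OF inj, of b f] that b(1) DC by blast
      then show ?thesis using b(2)[OF that(1)] by simp
    qed
    \<comment> \<open>\<open>b\<close> is the cheapest cell on which the two co-trees differ, so exchanging it into the one that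
         misses it evicts a dearer cell.\<close>
    have contra: False if c: "cotree X d T" "cotree X d T'" "b \<in> T" "b \<notin> T'" "?w T' \<le> ?w M"
      and D: "T - T' \<subseteq> ?D" "T' - T \<subseteq> ?D" for T T'
    proof -
      obtain f where f: "f \<in> T'" "f \<notin> T" "cotree X d (insert b (T' - {f}))"
        using cotree_exchange[OF c(1-4)] .
      have "?w (insert b (T' - {f})) = ?w T' - E f + E b"
        using c f top by (intro swap) blast+
      moreover have "E b < E f" using lt[of f] f D(2) c(3) by blast
      ultimately show False using min[OF f(3)] c(5) by simp
    qed
    show False
    proof (cases "b \<in> L")
      case True
      then show False using b(1) by (intro contra[OF L(1) M']) auto
    next
      case False
      then show False using b(1) le by (intro contra[OF M' L(1)]) auto
    qed
  qed
qed

section \<open>Finiteness of the torsion\<close>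

lemma of_int_boundary:
  assumes "b \<in> boundaries X (cells X) k"
  shows "(\<lambda>e. rat_of_int (b e)) \<in> boundaries X (cells X) k"
proof -
  obtain c where c: "c \<in> cell_chains X (cells X) (k + 1)" "b = bd X (k + 1) c"
    using assms by (auto simp: boundaries_def)
  have "(\<lambda>e. rat_of_int (b e)) = bd X (k + 1) (\<lambda>e. rat_of_int (c e))"
    by (auto simp: c(2) bd_def fun_eq_iff)
  moreover have "(\<lambda>e. rat_of_int (c e)) \<in> cell_chains X (cells X) (k + 1)"
    using c(1) by (simp add: cell_chains_def)
  ultimately show ?thesis by (auto simp: boundaries_def)
qed

lemma common_denominator:
  assumes "finite A"
  obtains N :: int where "N > 0" "\<And>a. a \<in> A \<Longrightarrow> \<exists>m :: int. of_int N * (q a :: rat) = of_int m"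
proof -
  have "\<exists>N :: int. N > 0 \<and> (\<forall>a\<in>A. \<exists>m :: int. of_int N * q a = of_int m)"
    using assms
  proof induction
    case (insert a A)
    then obtain N where N: "N > 0" "\<forall>a\<in>A. \<exists>m :: int. of_int N * q a = of_int m" by blast
    obtain u v where uv: "q a = of_int u / of_int v" "v > 0"
      by (metis quotient_of_div quotient_of_denom_pos surj_pair)
    show ?case
    proof (rule exI[of _ "v * N"], intro conjI ballI)
      show "v * N > 0" using N uv by simp
      fix b assume "b \<in> insert a A"
      then show "\<exists>m :: int. of_int (v * N) * q b = of_int m"
      proof
        assume "b = a"
        then have "of_int (v * N) * q b = of_int (u * N)" using uv by simp
        then show ?thesis by blast
      next
        assume "b \<in> A"
        then obtain m where "of_int N * q b = (of_int m :: rat)" using N(2) by blast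
        then have "of_int (v * N) * q b = (of_int (v * m) :: rat)" by simp
        then show ?thesis by blast
      qed
    qed
  qed (auto intro: exI[of _ 1])
  then show ?thesis using that by blast
qed

lemma integral_multiple_is_boundary:
  assumes "v \<in> boundaries X (cells X) k"
  obtains N :: int and b :: "'c \<Rightarrow> int" where "N > 0" "b \<in> boundaries X (cells X) k"
    "\<And>e. rat_of_int (b e) = of_int N * v e"
proof -
  obtain c :: "'c \<Rightarrow> rat" where c: "c \<in> cell_chains X (cells X) (k + 1)" "v = bd X (k + 1) c"
    using assms by (auto simp: boundaries_def)
  obtain N :: int where N: "N > 0" "\<And>a. a \<in> cells X \<Longrightarrow> \<exists>m :: int. of_int N * c a = of_int m"
    using common_denominator[OF finite_cwD(2)[OF X], of c] by blast
  define m where "m a = (if a \<in> cells_in X (cells X) (k + 1) then \<lfloor>of_int N * c a\<rfloor> else 0)" for a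
  have m: "rat_of_int (m a) = of_int N * c a" for a
  proof (cases "a \<in> cells_in X (cells X) (k + 1)")
    case True
    then obtain j :: int where "of_int N * c a = of_int j" using N(2)[of a] by (auto simp: cells_in_def)
    then show ?thesis using True by (simp add: m_def)
  qed (use c(1) in \<open>simp add: m_def cell_chains_def\<close>)
  have "m \<in> cell_chains X (cells X) (k + 1)" by (simp add: cell_chains_def m_def)
  moreover have "rat_of_int (bd X (k + 1) m e) = of_int N * v e" for e
    by (simp add: c(2) bd_def m sum_distrib_left mult.left_commute)
  ultimately show ?thesis using N(1) by (intro that[of N "bd X (k + 1) m"]) (auto simp: boundaries_def)
qed

lemma subspace_rel_boundaries: "fun_module.subspace (rel_boundaries X S T k :: ('c \<Rightarrow> 'f::comm_ring_1) set)"
proof -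
  let ?R = "{b + t | b t. b \<in> boundaries X S k \<and> t \<in> cell_chains X T k} :: ('c \<Rightarrow> 'f) set"
  have "(rel_boundaries X S T k :: ('c \<Rightarrow> 'f) set) = ?R"
    by (simp add: rel_boundaries_def plus_fun_def)
  moreover have "fun_module.subspace ?R"
    unfolding fun_module.subspace_def
  proof (intro conjI allI ballI)
    have "(0 :: 'c \<Rightarrow> 'f) = 0 + 0" by simp
    then show "(0 :: 'c \<Rightarrow> 'f) \<in> ?R"
      using fun_module.subspace_0[OF subspace_boundaries] fun_module.subspace_0[OF subspace_cell_chains] by blast
  next
    fix u v :: "'c \<Rightarrow> 'f"
    assume "u \<in> ?R"
      "v \<in> ?R"
    then obtain b t b' t' where bt: "b \<in> boundaries X S k" "t \<in> cell_chains X T k" "u = b + t"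
      "b' \<in> boundaries X S k" "t' \<in> cell_chains X T k" "v = b' + t'" by blast
    have "u + v = (b + b') + (t + t')" by (simp add: bt algebra_simps)
    then show "u + v \<in> ?R"
      using fun_module.subspace_add[OF subspace_boundaries bt(1,4)] fun_module.subspace_add[OF subspace_cell_chains bt(2,5)]
      by blast
  next
    fix r and u :: "'c \<Rightarrow> 'f"
    assume "u \<in> ?R"
    then obtain b t where bt: "b \<in> boundaries X S k" "t \<in> cell_chains X T k" "u = b + t" by blast
    have "r *f u = r *f b + r *f t" by (simp add: bt fun_eq_iff algebra_simps)
    then show "r *f u \<in> ?R"
      using fun_module.subspace_scale[OF subspace_boundaries bt(1)] fun_module.subspace_scale[OF subspace_cell_chains bt(2)]
      by blast
  qed
  ultimately show ?thesis by simp
qed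

lemma rel_cycles_cotree:
  assumes "cotree X d L"
  shows "rel_cycles X (cells X) L (d - 1) = (cell_chains X (cells X) (d - 1) :: ('c \<Rightarrow> 'f::comm_ring_1) set)"
proof -
  have "cells_in X L (d - 2) = cells_in X (cells X) (d - 2)"
    using assms by (intro skeleton_sandwich_cells(2)[OF X]) (auto simp: cotree_def)
  then have "cell_chains X L (d - 2) = (cell_chains X (cells X) (d - 2) :: ('c \<Rightarrow> 'f::comm_ring_1) set)"
    by (simp add: cell_chains_def)
  then show ?thesis
    using bd_in_cell_chains[of X "d - 1"] by (auto simp: rel_cycles_def)
qed

text \<open>The group is the quotient of the integral chains by the boundaries together with the chains of \<open>L\<close>.
  The rational complement property provides for every cell a positive integer \<open>n e\<close> that multiplies its unit chain
  into this subgroup. Reducing the coefficient at each cell \<open>e\<close> modulo \<open>n e\<close> shows that finitely many chains represent all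
  classes.\<close>

theorem torsion_order_pos:
  assumes L: "cotree X d L"
  shows "0 < torsion_order X d L"
proof -
  let ?k = "d - 1"
  let ?C = "cell_chains X (cells X) ?k :: ('c \<Rightarrow> int) set"
  let ?H = "rel_boundaries X (cells X) L ?k :: ('c \<Rightarrow> int) set"
  let ?A = "cells_in X (cells X) ?k"
  have comp: "boundary_complement X ?k L" by (rule cotree_imp_boundary_complement[OF X L])
  have H: "fun_module.subspace ?H" by (rule subspace_rel_boundaries)
  have finA: "finite ?A" by (rule finite_cells_in[OF X])
  have one: "\<exists>N :: int. N > 0 \<and> N *f unit_chain e \<in> ?H" if e: "e \<in> ?A" for e
  proof -
    have "(unit_chain e :: 'c \<Rightarrow> rat) \<in> cell_chains X (cells X) ?k" using e by (auto simp: cell_chains_def)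
    then obtain t :: "'c \<Rightarrow> rat" where t: "t \<in> cell_chains X L ?k" "unit_chain e - t \<in> boundaries X (cells X) ?k"
      using comp by (auto simp: boundary_complement_def)
    obtain N :: int and b :: "'c \<Rightarrow> int" where N: "N > 0" "b \<in> boundaries X (cells X) ?k"
      "\<And>f. rat_of_int (b f) = of_int N * (unit_chain e - t) f"
      using integral_multiple_is_boundary[OF t(2)] by blast
    let ?t = "N *f unit_chain e - b"
    have "?t f = 0" if "f \<notin> cells_in X L ?k" for f
    proof -
      have "t f = 0" using t(1) that by (simp add: cell_chains_def)
      then have "rat_of_int (b f) = rat_of_int (N * unit_chain e f)" using N(3)[of f] by simp
      then have "b f = N * unit_chain e f" by (simp only: of_int_eq_iff)
      then show ?thesis by simp
    qed
    then have "?t \<in> cell_chains X L ?k" by (simp add: cell_chains_def)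
    then have "(\<lambda>f. b f + ?t f) \<in> ?H" using N(2) unfolding rel_boundaries_def by blast
    moreover have "(\<lambda>f. b f + ?t f) = N *f unit_chain e" by (auto simp: fun_eq_iff)
    ultimately show ?thesis using N(1) by auto
  qed
  from one obtain n :: "'c \<Rightarrow> int" where n: "\<And>e. e \<in> ?A \<Longrightarrow> n e > 0 \<and> n e *f unit_chain e \<in> ?H"
    by metis
  let ?F = "{c :: 'c \<Rightarrow> int. (\<forall>e\<in>?A. c e \<in> {0..<n e}) \<and> (\<forall>e. e \<notin> ?A \<longrightarrow> c e = 0)}"
  have "finite ?F"
  proof -
    have "finite (Pi\<^sub>E ?A (\<lambda>e. {0..<n e}))" using finA by (intro finite_PiE) auto
    moreover have "?F \<subseteq> (\<lambda>g e. if e \<in> ?A then g e else 0) ` (Pi\<^sub>E ?A (\<lambda>e. {0..<n e}))"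
    proof
      fix c assume c: "c \<in> ?F"
      then have "c = (\<lambda>g e. if e \<in> ?A then g e else 0) (restrict c ?A)" "restrict c ?A \<in> Pi\<^sub>E ?A (\<lambda>e. {0..<n e})"
        by (auto simp: fun_eq_iff)
      then show "c \<in> (\<lambda>g e. if e \<in> ?A then g e else 0) ` (Pi\<^sub>E ?A (\<lambda>e. {0..<n e}))" by blast
    qed
    ultimately show ?thesis using finite_surj by blast
  qed
  have "translate ?H ` ?C \<subseteq> translate ?H ` ?F"
  proof
    fix h assume "h \<in> translate ?H ` ?C"
    then obtain c where c: "c \<in> ?C" "h = translate ?H c" by blast
    let ?r = "\<lambda>e. if e \<in> ?A then c e mod n e else 0"
    have "?r \<in> ?F" using n by auto
    have "c - ?r = (\<Sum>e\<in>?A. (c e div n e) *f (n e *f unit_chain e))"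
    proof
      fix f
      have "(\<Sum>e\<in>?A. (c e div n e) *f (n e *f unit_chain e)) f
        = (\<Sum>e\<in>?A. if e = f then (c f div n f) * n f else 0)"
        unfolding sum_apply by (intro sum.cong) auto
      also have "\<dots> = (if f \<in> ?A then (c f div n f) * n f else 0)" using finA by (simp add: sum.delta)
      also have "\<dots> = (c - ?r) f" using c(1) by (simp add: cell_chains_def minus_mod_eq_div_mult)
      finally show "(c - ?r) f = (\<Sum>e\<in>?A. (c e div n e) *f (n e *f unit_chain e)) f" by simp
    qed
    also have "\<dots> \<in> ?H"
    proof (rule fun_module.subspace_sum[OF H])
      show "(c e div n e) *f (n e *f unit_chain e) \<in> ?H" if "e \<in> ?A" for e
        by (rule fun_module.subspace_scale[OF H]) (rule n[OF that, THEN conjunct2])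
    qed
    finally have "h = translate ?H ?r" unfolding c(2) by (simp add: translate_eq_iff[OF H])
    then show "h \<in> translate ?H ` ?F" using \<open>?r \<in> ?F\<close> by blast
  qed
  then have "finite (translate ?H ` ?C)" by (rule finite_subset) (rule finite_imageI[OF \<open>finite ?F\<close>])
  moreover have "translate ?H ` ?C \<noteq> {}" using fun_module.subspace_0[OF subspace_cell_chains] by blast
  ultimately show ?thesis
    by (simp add: torsion_order_def order_def rel_homology_def carrier_quotient rel_cycles_cotree[OF L] card_gt_0_iff)
qed

section \<open>Lifting homology classes to cycles\<close>

lemma rationalize_carrier:
  assumes "x \<in> carrier (homology X (cells X) k)"
  shows "rationalize X k x \<in> carrier (homology X (cells X) k)"
proof -
  let ?B = "boundaries X (cells X) k :: ('c \<Rightarrow> rat) set" and ?BZ = "boundaries X (cells X) k :: ('c \<Rightarrow> int) set"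
  let ?q = "\<lambda>(c :: 'c \<Rightarrow> int) e. rat_of_int (c e)"
  obtain z where z: "z \<in> cycles X (cells X) k" "x = translate ?BZ z"
    using assms by (auto simp: carrier_homology)
  have "?q ` x = translate (?q ` ?BZ) (?q z)"
    by (force simp: z(2) translate_def image_image fun_eq_iff)
  moreover have "?q ` ?BZ \<subseteq> ?B" using of_int_boundary by blast
  moreover have "0 \<in> ?q ` ?BZ"
    using fun_module.subspace_0[OF subspace_boundaries[of X "cells X" k]] by (intro image_eqI[of _ _ 0]) (auto simp: fun_eq_iff)
  ultimately have "rationalize X k x = translate ?B (?q z)"
    unfolding rationalize_def incl_map_def set_mult_additive_group
    by (simp only: translate_absorb[OF subspace_boundaries])
  moreover have "?q z \<in> cycles X (cells X) k"
  proof -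
    have "bd X k (?q z) e = rat_of_int (bd X k z e)" for e by (simp add: bd_def)
    then show ?thesis using z(1) by (auto simp: cycles_def cell_chains_def fun_eq_iff)
  qed
  ultimately show ?thesis by (auto simp: carrier_homology)
qed

lemma psi_cycle:
  assumes L: "cotree X d L" and h: "h \<in> carrier (homology X (cells X) (d - 1))"
  shows "psi X d L h \<in> cycles X (cells X) (d - 1)"
proof -
  have "L \<subseteq> cells X" using L by (auto simp: cotree_def subcomplex_def)
  have "incl_map X (d - 1) ` carrier (homology X L (d - 1) :: ('c \<Rightarrow> rat) set monoid) = carrier (homology X (cells X) (d - 1))"
    using L by (simp add: cotree_def iso_def bij_betw_def)
  then have "phi X d L ` cycles X L (d - 1) = carrier (homology X (cells X) (d - 1))"
    by (simp add: phi_def[abs_def] homology_class_eq carrier_homology image_image)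
  then have "psi X d L h \<in> cycles X L (d - 1)"
    unfolding psi_def using h by (intro inv_into_into) simp
  then show ?thesis using cycles_mono[OF \<open>L \<subseteq> cells X\<close>] by blast
qed

end

section \<open>The low temperature limit\<close>

lemma tendsto_exp_gap:
  assumes "(c :: real) > 0"
  shows "((\<lambda>\<beta>. exp (- \<beta> * c)) \<longlongrightarrow> 0) at_top"
proof -
  have "filterlim (\<lambda>\<beta>. c * \<beta>) at_top at_top"
    by (rule filterlim_tendsto_pos_mult_at_top[OF tendsto_const assms filterlim_ident])
  then have "filterlim (\<lambda>\<beta>. - (c * \<beta>)) at_bot at_top" by (simp add: filterlim_uminus_at_top)
  then have "((\<lambda>\<beta>. exp (- (c * \<beta>))) \<longlongrightarrow> 0) at_top" by (rule filterlim_compose[OF exp_at_bot])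
  then show ?thesis by (simp add: mult.commute)
qed

lemma tau_eq:
  assumes "finite (cells_in X L (d - 1))"
  shows "tau X d E \<beta> L = (real (torsion_order X d L))\<^sup>2 * exp (- \<beta> * (\<Sum>b\<in>cells_in X L (d - 1). E b))"
  using assms by (simp add: tau_def exp_sum[symmetric] sum_distrib_left)

text \<open>Dividing numerator and denominator by the weight of the ground state \<open>M\<close> leaves ratios
  that tend to \<open>0\<close>, except for the ratio \<open>1\<close> of \<open>M\<close> itself.\<close>

lemma gibbs_weights_concentrate:
  fixes a w :: "'l \<Rightarrow> real"
  assumes fin: "finite S" and M: "M \<in> S" and a: "\<And>L. L \<in> S \<Longrightarrow> a L > 0"
    and gap: "\<And>L. L \<in> S \<Longrightarrow> L \<noteq> M \<Longrightarrow> w M < w L" and L: "L \<in> S"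
  shows "((\<lambda>\<beta>. a L * exp (- \<beta> * w L) / (\<Sum>K\<in>S. a K * exp (- \<beta> * w K))) \<longlongrightarrow> (if L = M then 1 else 0)) at_top"
proof -
  define r where "r K \<beta> = a K / a M * exp (- \<beta> * (w K - w M))" for K \<beta>
  have r: "(r K \<longlongrightarrow> (if K = M then 1 else 0)) at_top" if "K \<in> S" for K
  proof (cases "K = M")
    case True
    then have "r K = (\<lambda>_. 1)" using a[OF M] by (auto simp: r_def)
    then show ?thesis using True by simp
  next
    case False
    have "((\<lambda>\<beta>. a K / a M * exp (- \<beta> * (w K - w M))) \<longlongrightarrow> a K / a M * 0) at_top"
      using gap[OF that False] by (intro tendsto_mult_left tendsto_exp_gap) simp
    then show ?thesis using False by (simp add: r_def[abs_def])
  qed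
  define g where "g \<beta> = a M * exp (- \<beta> * w M)" for \<beta>
  have rw: "a K * exp (- \<beta> * w K) = g \<beta> * r K \<beta>" for K \<beta>
  proof -
    have "exp (- \<beta> * w K) = exp (- \<beta> * w M) * exp (- \<beta> * (w K - w M))"
      by (simp add: exp_add[symmetric] algebra_simps)
    then show ?thesis using a[OF M] by (simp add: r_def g_def)
  qed
  have "((\<lambda>\<beta>. \<Sum>K\<in>S. r K \<beta>) \<longlongrightarrow> (\<Sum>K\<in>S. if K = M then 1 else 0)) at_top"
    by (intro tendsto_sum r)
  then have "((\<lambda>\<beta>. \<Sum>K\<in>S. r K \<beta>) \<longlongrightarrow> 1) at_top" using fin M by (simp add: sum.delta)
  from tendsto_divide[OF r[OF L] this]
  have "((\<lambda>\<beta>. r L \<beta> / (\<Sum>K\<in>S. r K \<beta>)) \<longlongrightarrow> (if L = M then 1 else 0)) at_top" by simp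
  moreover have "a L * exp (- \<beta> * w L) / (\<Sum>K\<in>S. a K * exp (- \<beta> * w K)) = r L \<beta> / (\<Sum>K\<in>S. r K \<beta>)" for \<beta>
  proof -
    have "g \<beta> \<noteq> 0" using a[OF M] by (simp add: g_def)
    then show ?thesis by (simp only: rw sum_distrib_left[symmetric]) simp
  qed
  ultimately show ?thesis by simp
qed

theorem corollary2:
  fixes X :: "('a, 'c) cw"
    and d :: int
    and x :: "('c \<Rightarrow> int) set"
    and E :: "'c \<Rightarrow> real"
    and L\<mu> :: "'c set"
  assumes "finite_cw X"
    and "connected_space (space_of X)"
    and "1 \<le> d" and "d \<le> cw_dim X"
    and "x \<in> carrier (homology X (cells X) (d - 1))"
    and "inj_on E (cells_in X (cells X) (d - 1))"
    and "minimal_cotree X d E L\<mu>"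
  shows "(\<forall>L. cotree X d L \<longrightarrow>
            ((\<lambda>\<beta>. tau X d E \<beta> L / nabla X d E \<beta>) \<longlongrightarrow> (if L = L\<mu> then 1 else 0)) at_top) \<and>
         psi X d L\<mu> (rationalize X (d - 1) x) \<in> cycles X (cells X) (d - 1) \<and>
         ((\<lambda>\<beta>. boltzmann X d E x \<beta>) \<longlongrightarrow>
            (\<lambda>b. of_rat (psi X d L\<mu> (rationalize X (d - 1) x) b))) at_top"
proof -
  note X = assms(1)
  let ?S = "Collect (cotree X d)"
  let ?w = "\<lambda>L. \<Sum>b\<in>cells_in X L (d - 1). E b"
  let ?a = "\<lambda>L. (real (torsion_order X d L))\<^sup>2"
  let ?h = "rationalize X (d - 1) x"
  have M: "cotree X d L\<mu>" using assms(7) by (simp add: minimal_cotree_def is_arg_min_def)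
  have fin: "finite ?S" by (rule finite_cotrees[OF X])
  have tau: "tau X d E \<beta> L = ?a L * exp (- \<beta> * ?w L)" if "L \<in> ?S" for L \<beta>
  proof (rule tau_eq)
    have "cells_in X L (d - 1) \<subseteq> cells X" using that by (auto simp: cotree_def subcomplex_def cells_in_def)
    then show "finite (cells_in X L (d - 1))" using finite_cwD(2)[OF X] finite_subset by blast
  qed
  have ratio: "((\<lambda>\<beta>. tau X d E \<beta> L / nabla X d E \<beta>) \<longlongrightarrow> (if L = L\<mu> then 1 else 0)) at_top"
    if L: "cotree X d L" for L
  proof -
    have "((\<lambda>\<beta>. ?a L * exp (- \<beta> * ?w L) / (\<Sum>K\<in>?S. ?a K * exp (- \<beta> * ?w K)))
        \<longlongrightarrow> (if L = L\<mu> then 1 else 0)) at_top"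
      using torsion_order_pos[OF X] minimal_cotree_strict[OF X assms(6,7)] L M
      by (intro gibbs_weights_concentrate[OF fin]) auto
    then show ?thesis using tau L by (simp add: nabla_def)
  qed
  have "((\<lambda>\<beta>. boltzmann X d E x \<beta> b) \<longlongrightarrow> of_rat (psi X d L\<mu> ?h b)) at_top" for b
  proof -
    have "((\<lambda>\<beta>. \<Sum>L\<in>?S. tau X d E \<beta> L / nabla X d E \<beta> * of_rat (psi X d L ?h b))
      \<longlongrightarrow> (\<Sum>L\<in>?S. (if L = L\<mu> then 1 else 0) * of_rat (psi X d L ?h b))) at_top"
      by (intro tendsto_sum tendsto_mult_right ratio) simp
    also have "(\<Sum>L\<in>?S. (if L = L\<mu> then 1 else 0) * of_rat (psi X d L ?h b)) = (of_rat (psi X d L\<mu> ?h b) :: real)"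
    proof -
      have "(\<Sum>L\<in>?S. (if L = L\<mu> then 1 else 0) * of_rat (psi X d L ?h b))
        = (\<Sum>L\<in>?S. if L = L\<mu> then (of_rat (psi X d L\<mu> ?h b) :: real) else 0)"
        by (intro sum.cong) auto
      then show ?thesis using fin M by (simp add: sum.delta)
    qed
    also have "(\<lambda>\<beta>. \<Sum>L\<in>?S. tau X d E \<beta> L / nabla X d E \<beta> * of_rat (psi X d L ?h b)) = (\<lambda>\<beta>. boltzmann X d E x \<beta> b)"
      by (simp add: boltzmann_def sum_distrib_left)
    finally show ?thesis .
  qed
  then have "((\<lambda>\<beta>. boltzmann X d E x \<beta>) \<longlongrightarrow> (\<lambda>b. of_rat (psi X d L\<mu> ?h b))) at_top"
    unfolding limitin_canonical_iff[symmetric] euclidean_product_topology[symmetric]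
    by (simp add: limitin_componentwise)
  then show ?thesis
    using ratio psi_cycle[OF X M rationalize_carrier[OF X assms(5)]] by blast
qed

end
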